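(* In the setting of the context, where $\lambda_k(x,t)=a(x,t)p_k(x)$, assume: (i) there are constants $0<K_1<K_2$ with $K_1\le a(x,t)\le K_2$ for all $(x,t)\in\mathbb R\times[0,T]$; $a(\cdot,t)$ is continuously differentiable in $x$, and $a'(x,t)=\partial_x a(x,t)$ is continuous in $x$ and uniformly bounded on $\mathbb R\times[0,T]$; (ii) each $p_k$ is continuously differentiable with $p_k'$ continuous and bounded, and $\inf_{x\in\mathbb R,\,1\le k\le n}p_k(x)>0$. Then for any $q\in\mathbb R$, $$\sup_{0\le t\le T}\mathbb E^{\mathbb Q}\big[|M(t)|^q\big]<\infty.$$ Consequently, for any $u\in\mathcal U_{ad}$, $$\mathbb E^{\mathbb Q}\int_0^T|u(t)|^4\,dt<\infty.$$
   Context: **State.** Fix $T>0$. Let $(\Omega,\mathcal F,\{\mathcal F_t\}_{t\in[0,T]},\mathbb P)$ be a complete filtered probability space supporting a standard Brownian motion $W$ and an independent Poisson random measure $\bar N(d\zeta,dt)$ on $\mathbb R^+\times\mathcal E$ with $\sigma$-finite intensity measure $\nu(d\zeta)dt$, where $\mathcal E$ is a Polish space and $\int_{\mathcal E}(1\wedge|\zeta|^2)\nu(d\zeta)<\infty$; $\tilde N=\bar N-\nu\,dt$. Let $\mathbb U\subseteq\mathbb R$ be non-empty and convex. For a $\mathbb U$-valued control $u(\cdot)$ the state $X$ solves on $[0,T]$ $$dX(t)=b(t,X(t),u(t))dt+\sigma(t,X(t),u(t))dW(t)+\int_{\mathcal E}\eta(t,X(t-),u(t-),\zeta)\tilde N(d\zeta,dt),\quad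 X(0)=x\in\mathbb R,$$ with deterministic $b,\sigma:[0,T]\times\mathbb R\times\mathbb U\to\mathbb R$ and $\eta:[0,T]\times\mathbb R\times\mathbb U\times\mathcal E\to\mathbb R$. **Observations.** $\overrightarrow Y=(Y_1,\dots,Y_n)$ with $Y_k(t)=N_k\big(\int_0^t\lambda_k(X(s-),s-)ds\big)$, where under $\mathbb P$ the processes $N_1,\dots,N_n$ are independent unit Poisson processes and $\{N_1,\dots,N_n\}$ is independent of $X$. The intensities have the form $\lambda_k(x,t)=a(x,t)p_k(x)$, where $a(x,t)=\sum_{k=1}^n\lambda_k(x,t)$ is the total intensity and $p_k(x)=p(y_k\mid x)$ is the transition probability from $x$ to the $k$-th price level $y_k$, with $\sum_{k=1}^np_k(x)=1$ for all $x$. Put $\mathcal F^{\overrightarrow Y}_t=\sigma\{\overrightarrow Y(s):0\le s\le t\}$. **Controls.** $\mathcal U_{ad}$ is the set of $\mathbb U$-valued $\mathcal F^{\overrightarrow Y}_t$-predictable processes $u$ with $\mathbb E^{\mathbb P}\int_0^T|u(t)|^{4p_0}dt<\infty$ for some $p_0>1$. **Reference measure.** Let $\hat{\mathcal F}_t=\mathcal F^W_t\vee\mathcal F^{\tilde N}_t\vee\mathcal F^{\overrightarrow Y}_t\vee\mathcal N$, $\mathcal N$ the $\mathbb P$-null sets. By Girsanov's theorem for point processes there is a probability measure $\mathbb Q$, equivalent to $\mathbb P$ on $\hat{\mathcal F}_T$, under which $X$ retains its $\mathbb P$-law and $Y_1,\dots,Y_n$ are independent unit Poisson processes independent of $X$.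 The likelihood ratio $M(t)=\frac{d\mathbb P}{d\mathbb Q}\big|_{\hat{\mathcal F}_t}$ satisfies $$dM(t)=\sum_{k=1}^n(\lambda_k(X(t-),t-)-1)M(t-)\,d(Y_k(t)-t),\quad M(0)=1.$$ *)

theory Defs
  imports "HOL-Probability.Probability"
begin

section \<open>Paths\<close>

text \<open>
  The value f(t-). Where there is no left limit (in particular at the initial time 0) we use the
  convention f(t-) = f(t); this matters for controls and intensities, whose paths are not
  assumed to have left limits.
\<close>

definition left_lim :: "(real \<Rightarrow> real) \<Rightarrow> real \<Rightarrow> real" where
  "left_lim f t =
     (if 0 < t \<and> (\<exists>l. (f \<longlongrightarrow> l) (at_left t)) then Lim (at_left t) f else f t)"

definition cadlag_on :: "real \<Rightarrow> (real \<Rightarrow> real) \<Rightarrow> bool" where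
  "cadlag_on T f \<longleftrightarrow>
     (\<forall>t\<in>{0..<T}. continuous (at_right t) f) \<and> (\<forall>t\<in>{0<..T}. \<exists>l. (f \<longlongrightarrow> l) (at_left t))"

text \<open>
  The Lebesgue-Stieltjes integral of h with respect to a nondecreasing right-continuous f on
  [0,T], over (0,t]. The integrator of an interval measure lives on the whole line, so f is
  extended by constants outside of [0,T].
\<close>

definition stieltjes_integral ::
    "real \<Rightarrow> (real \<Rightarrow> real) \<Rightarrow> (real \<Rightarrow> real) \<Rightarrow> real \<Rightarrow> real" where
  "stieltjes_integral T h f t =
     (LINT s:{0<..t}|interval_measure (\<lambda>s. f (max 0 (min s T))). h s)"


section \<open>Generated sigma-algebras, predictability\<close>

definition generated ::
    "'a set \<Rightarrow> 'i set \<Rightarrow> 'b measure \<Rightarrow> ('i \<Rightarrow> 'a \<Rightarrow> 'b) \<Rightarrow> 'a measure" where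
  "generated \<Omega> I S f = sigma \<Omega> {f i -` A \<inter> \<Omega> | i A. i \<in> I \<and> A \<in> sets S}"

definition predictable_algebra ::
    "real \<Rightarrow> 'a set \<Rightarrow> (real \<Rightarrow> 'a measure) \<Rightarrow> (real \<times> 'a) measure" where
  "predictable_algebra T \<Omega> G = sigma ({0..T} \<times> \<Omega>)
     ({{0} \<times> A | A. A \<in> sets (G 0)} \<union>
      {{s<..r} \<times> A | s r A. 0 \<le> s \<and> s < r \<and> r \<le> T \<and> A \<in> sets (G s)})"

definition predictable ::
    "real \<Rightarrow> 'a set \<Rightarrow> (real \<Rightarrow> 'a measure) \<Rightarrow> (real \<Rightarrow> 'a \<Rightarrow> real) \<Rightarrow> bool" where
  "predictable T \<Omega> G u \<longleftrightarrow> (\<lambda>(t, \<omega>). u t \<omega>) \<in> borel_measurable (predictable_algebra T \<Omega> G)"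

definition complete_filtered_prob_space ::
    "real \<Rightarrow> 'a measure \<Rightarrow> (real \<Rightarrow> 'a measure) \<Rightarrow> bool" where
  "complete_filtered_prob_space T P F \<longleftrightarrow>
     prob_space P \<and> complete_measure P \<and> filtration (space P) F \<and>
     (\<forall>t\<in>{0..T}. subalgebra P (F t)) \<and> null_sets P \<subseteq> sets (F 0)"


section \<open>Driving noises\<close>

definition brownian_motion ::
    "real \<Rightarrow> 'a measure \<Rightarrow> (real \<Rightarrow> 'a measure) \<Rightarrow> (real \<Rightarrow> 'a \<Rightarrow> real) \<Rightarrow> bool" where
  "brownian_motion T P F W \<longleftrightarrow>
     (\<forall>t\<in>{0..T}. W t \<in> borel_measurable (F t)) \<and>
     (AE \<omega> in P. W 0 \<omega> = 0 \<and> continuous_on {0..T} (\<lambda>t. W t \<omega>)) \<and>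
     (\<forall>s t. 0 \<le> s \<and> s < t \<and> t \<le> T \<longrightarrow>
        distributed P lborel (\<lambda>\<omega>. W t \<omega> - W s \<omega>) (normal_density 0 (sqrt (t - s))) \<and>
        prob_space.indep_set P (sets (F s))
          (sets (generated (space P) {()} borel (\<lambda>_ \<omega>. W t \<omega> - W s \<omega>))))"

definition prm_intensity :: "'e measure \<Rightarrow> (real \<times> 'e) measure" where
  "prm_intensity \<nu> = restrict_space lborel {0..} \<Otimes>\<^sub>M \<nu>"

definition poisson_random_measure ::
    "real \<Rightarrow> 'a measure \<Rightarrow> (real \<Rightarrow> 'a measure) \<Rightarrow> 'e measure \<Rightarrow> ('a \<Rightarrow> (real \<times> 'e) measure) \<Rightarrow> bool"
  where
  "poisson_random_measure T P F \<nu> Nb \<longleftrightarrow>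
     (\<forall>\<omega>\<in>space P. sets (Nb \<omega>) = sets (prm_intensity \<nu>)) \<and>
     (\<forall>A\<in>sets (prm_intensity \<nu>). (\<lambda>\<omega>. emeasure (Nb \<omega>) A) \<in> borel_measurable P) \<and>
     (\<forall>A\<in>sets (prm_intensity \<nu>). emeasure (prm_intensity \<nu>) A < \<infinity> \<longrightarrow>
        (\<forall>j::nat. measure P {\<omega>\<in>space P. emeasure (Nb \<omega>) A = of_nat j} =
           measure (prm_intensity \<nu>) A ^ j / fact j * exp (- measure (prm_intensity \<nu>) A))) \<and>
     (\<forall>A\<in>sets (prm_intensity \<nu>). emeasure (prm_intensity \<nu>) A = \<infinity> \<longrightarrow>
        (AE \<omega> in P. emeasure (Nb \<omega>) A = \<infinity>)) \<and>
     (\<forall>(A :: nat \<Rightarrow> (real \<times> 'e) set) J.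
        finite J \<and> disjoint_family_on A J \<and> A ` J \<subseteq> sets (prm_intensity \<nu>) \<longrightarrow>
        prob_space.indep_vars P (\<lambda>_. borel) (\<lambda>j \<omega>. emeasure (Nb \<omega>) (A j)) J) \<and>
     (\<forall>t\<in>{0..T}. \<forall>A\<in>sets (prm_intensity \<nu>). A \<subseteq> {0..t} \<times> UNIV \<longrightarrow>
        (\<lambda>\<omega>. emeasure (Nb \<omega>) A) \<in> borel_measurable (F t)) \<and>
     (\<forall>s\<in>{0..T}. prob_space.indep_set P (sets (F s))
        (sets (generated (space P) {A \<in> sets (prm_intensity \<nu>). A \<subseteq> {s<..T} \<times> UNIV} borel
           (\<lambda>A \<omega>. emeasure (Nb \<omega>) A))))"


section \<open>Stochastic integrals and the state equation\<close>

text \<open>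
  A simple predictable integrand is a finite sum of terms xi 1_(s,r] with xi bounded and
  F_s-measurable, represented by the list of the triples (s, r, xi). For the random measure
  there is an additional factor 1_A with A of finite intensity.

  Stochastic integrals of general integrands are limits of integrals of simple ones, along
  approximations in L^2(dt) resp. L^2(nu dt) for almost every path. Passing to subsequences,
  almost sure convergence here is the same as the more usual convergence in probability
  (uniform on compacts for the integrals), so all integrands that are
  locally square integrable almost surely are covered.
\<close>

definition simple_integrand ::
    "real \<Rightarrow> 'a measure \<Rightarrow> (real \<Rightarrow> 'a measure) \<Rightarrow> (real \<times> real \<times> ('a \<Rightarrow> real)) list \<Rightarrow> bool" where
  "simple_integrand T P F hs \<longleftrightarrow>
     (\<forall>(s, r, \<xi>)\<in>set hs. 0 \<le> s \<and> s \<le> r \<and> r \<le> T \<and>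
        \<xi> \<in> borel_measurable (F s) \<and> bounded (\<xi> ` space P))"

definition simple_value :: "(real \<times> real \<times> ('a \<Rightarrow> real)) list \<Rightarrow> real \<Rightarrow> 'a \<Rightarrow> real" where
  "simple_value hs t \<omega> = (\<Sum>(s, r, \<xi>)\<leftarrow>hs. \<xi> \<omega> * indicator {s<..r} t)"

definition simple_ito ::
    "(real \<Rightarrow> 'a \<Rightarrow> real) \<Rightarrow> (real \<times> real \<times> ('a \<Rightarrow> real)) list \<Rightarrow> real \<Rightarrow> 'a \<Rightarrow> real" where
  "simple_ito W hs t \<omega> = (\<Sum>(s, r, \<xi>)\<leftarrow>hs. \<xi> \<omega> * (W (min r t) \<omega> - W (min s t) \<omega>))"

definition ito_integral ::
    "real \<Rightarrow> 'a measure \<Rightarrow> (real \<Rightarrow> 'a measure) \<Rightarrow> (real \<Rightarrow> 'a \<Rightarrow> real) \<Rightarrow>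
     (real \<Rightarrow> 'a \<Rightarrow> real) \<Rightarrow> (real \<Rightarrow> 'a \<Rightarrow> real) \<Rightarrow> bool" where
  "ito_integral T P F W H I \<longleftrightarrow>
     (\<exists>hs :: nat \<Rightarrow> _. (\<forall>m. simple_integrand T P F (hs m)) \<and>
       (AE \<omega> in P.
          (\<lambda>s. H s \<omega>) \<in> borel_measurable (restrict_space borel {0..T}) \<and>
          (\<lambda>m. \<integral>\<^sup>+s\<in>{0..T}. ennreal ((simple_value (hs m) s \<omega> - H s \<omega>)\<^sup>2) \<partial>lborel) \<longlonglongrightarrow> 0 \<and>
          uniform_limit {0..T} (\<lambda>m t. simple_ito W (hs m) t \<omega>) (\<lambda>t. I t \<omega>) sequentially))"

definition simple_jump_integrand ::
    "real \<Rightarrow> 'a measure \<Rightarrow> (real \<Rightarrow> 'a measure) \<Rightarrow> 'e measure \<Rightarrow>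
     (real \<times> real \<times> 'e set \<times> ('a \<Rightarrow> real)) list \<Rightarrow> bool" where
  "simple_jump_integrand T P F \<nu> hs \<longleftrightarrow>
     (\<forall>(s, r, A, \<xi>)\<in>set hs. 0 \<le> s \<and> s \<le> r \<and> r \<le> T \<and> A \<in> sets \<nu> \<and> emeasure \<nu> A < \<infinity> \<and>
        \<xi> \<in> borel_measurable (F s) \<and> bounded (\<xi> ` space P))"

definition simple_jump_value ::
    "(real \<times> real \<times> 'e set \<times> ('a \<Rightarrow> real)) list \<Rightarrow> real \<Rightarrow> 'a \<Rightarrow> 'e \<Rightarrow> real" where
  "simple_jump_value hs t \<omega> \<zeta> =
     (\<Sum>(s, r, A, \<xi>)\<leftarrow>hs. \<xi> \<omega> * indicator {s<..r} t * indicator A \<zeta>)"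

definition simple_jump_integral ::
    "'e measure \<Rightarrow> ('a \<Rightarrow> (real \<times> 'e) measure) \<Rightarrow>
     (real \<times> real \<times> 'e set \<times> ('a \<Rightarrow> real)) list \<Rightarrow> real \<Rightarrow> 'a \<Rightarrow> real" where
  "simple_jump_integral \<nu> Nb hs t \<omega> =
     (\<Sum>(s, r, A, \<xi>)\<leftarrow>hs. \<xi> \<omega> *
        (measure (Nb \<omega>) ({min s t<..min r t} \<times> A) - (min r t - min s t) * measure \<nu> A))"

definition compensated_integral ::
    "real \<Rightarrow> 'a measure \<Rightarrow> (real \<Rightarrow> 'a measure) \<Rightarrow> 'e measure \<Rightarrow> ('a \<Rightarrow> (real \<times> 'e) measure) \<Rightarrow>
     (real \<Rightarrow> 'a \<Rightarrow> 'e \<Rightarrow> real) \<Rightarrow> (real \<Rightarrow> 'a \<Rightarrow> real) \<Rightarrow> bool" where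
  "compensated_integral T P F \<nu> Nb H J \<longleftrightarrow>
     (\<exists>hs :: nat \<Rightarrow> _. (\<forall>m. simple_jump_integrand T P F \<nu> (hs m)) \<and>
       (AE \<omega> in P.
          (\<lambda>(s, \<zeta>). H s \<omega> \<zeta>) \<in> borel_measurable (restrict_space borel {0..T} \<Otimes>\<^sub>M \<nu>) \<and>
          (\<lambda>m. \<integral>\<^sup>+s\<in>{0..T}. (\<integral>\<^sup>+\<zeta>. ennreal ((simple_jump_value (hs m) s \<omega> \<zeta> - H s \<omega> \<zeta>)\<^sup>2) \<partial>\<nu>)
             \<partial>lborel) \<longlonglongrightarrow> 0 \<and>
          uniform_limit {0..T} (\<lambda>m t. simple_jump_integral \<nu> Nb (hs m) t \<omega>) (\<lambda>t. J t \<omega>)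
            sequentially))"

definition state_equation ::
    "real \<Rightarrow> 'a measure \<Rightarrow> (real \<Rightarrow> 'a measure) \<Rightarrow> 'e measure \<Rightarrow>
     (real \<Rightarrow> 'a \<Rightarrow> real) \<Rightarrow> ('a \<Rightarrow> (real \<times> 'e) measure) \<Rightarrow>
     (real \<Rightarrow> real \<Rightarrow> real \<Rightarrow> real) \<Rightarrow> (real \<Rightarrow> real \<Rightarrow> real \<Rightarrow> real) \<Rightarrow>
     (real \<Rightarrow> real \<Rightarrow> real \<Rightarrow> 'e \<Rightarrow> real) \<Rightarrow>
     real \<Rightarrow> (real \<Rightarrow> 'a \<Rightarrow> real) \<Rightarrow> (real \<Rightarrow> 'a \<Rightarrow> real) \<Rightarrow> bool" where
  "state_equation T P F \<nu> W Nb b \<sigma> \<eta> x0 u X \<longleftrightarrow>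
     (\<forall>t\<in>{0..T}. X t \<in> borel_measurable (F t)) \<and>
     (AE \<omega> in P. cadlag_on T (\<lambda>t. X t \<omega>)) \<and>
     (\<exists>I J.
        ito_integral T P F W (\<lambda>t \<omega>. \<sigma> t (X t \<omega>) (u t \<omega>)) I \<and>
        compensated_integral T P F \<nu> Nb
          (\<lambda>t \<omega> \<zeta>. \<eta> t (left_lim (\<lambda>r. X r \<omega>) t) (left_lim (\<lambda>r. u r \<omega>) t) \<zeta>) J \<and>
        (AE \<omega> in P.
           set_integrable lborel {0..T} (\<lambda>s. b s (X s \<omega>) (u s \<omega>)) \<and>
           (\<forall>t\<in>{0..T}. X t \<omega> =
              x0 + (LINT s:{0..t}|lborel. b s (X s \<omega>) (u s \<omega>)) + I t \<omega> + J t \<omega>)))"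


section \<open>Unit Poisson processes\<close>

definition counting_path :: "real set \<Rightarrow> (real \<Rightarrow> nat) \<Rightarrow> bool" where
  "counting_path I f \<longleftrightarrow>
     f 0 = 0 \<and> mono_on I f \<and>
     (\<forall>t\<in>I. continuous (at t within {t..} \<inter> I) f) \<and>
     (\<forall>t\<in>I. \<exists>l. (f \<longlongrightarrow> l) (at t within {..<t} \<inter> I) \<and> f t \<le> l + 1)"

text \<open>The time set I is [0,T] or [0,oo).\<close>

definition unit_poisson_process ::
    "'a measure \<Rightarrow> real set \<Rightarrow> (real \<Rightarrow> 'a \<Rightarrow> nat) \<Rightarrow> bool" where
  "unit_poisson_process M I N \<longleftrightarrow>
     (\<forall>t\<in>I. N t \<in> measurable M (count_space UNIV)) \<and>
     (AE \<omega> in M. counting_path I (\<lambda>t. N t \<omega>)) \<and>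
     (\<forall>s\<in>I. \<forall>t\<in>I. s < t \<longrightarrow>
        distr M (count_space UNIV) (\<lambda>\<omega>. N t \<omega> - N s \<omega>) = measure_pmf (poisson_pmf (t - s)) \<and>
        prob_space.indep_set M
          (sets (generated (space M) {()} (count_space UNIV) (\<lambda>_ \<omega>. N t \<omega> - N s \<omega>)))
          (sets (generated (space M) (I \<inter> {..s}) (count_space UNIV) N)))"

definition poisson_system_indep_of ::
    "'a measure \<Rightarrow> real \<Rightarrow> nat \<Rightarrow> real set \<Rightarrow> (nat \<Rightarrow> real \<Rightarrow> 'a \<Rightarrow> nat) \<Rightarrow> (real \<Rightarrow> 'a \<Rightarrow> real) \<Rightarrow> bool"
  where
  "poisson_system_indep_of M T n I Z X \<longleftrightarrow>
     (\<forall>k\<in>{1..n}. unit_poisson_process M I (Z k)) \<and>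
     prob_space.indep_sets M
       (\<lambda>k. sets (generated (space M) I (count_space UNIV) (Z k))) {1..n} \<and>
     prob_space.indep_set M
       (sets (generated (space M) ({1..n} \<times> I) (count_space UNIV) (\<lambda>(k, t). Z k t)))
       (sets (generated (space M) {0..T} borel X))"


section \<open>Observations, controls and the reference measure\<close>

text \<open>k is the index of the price level, x the state, t the time.\<close>

definition intensity :: "(real \<Rightarrow> real \<Rightarrow> real) \<Rightarrow> (nat \<Rightarrow> real \<Rightarrow> real) \<Rightarrow> nat \<Rightarrow> real \<Rightarrow> real \<Rightarrow> real"
  where "intensity a p k x t = a x t * p k x"

text \<open>The process s |-> lambda_k(X(s-), s-) along a path X.\<close>

definition intensity_left ::
    "(real \<Rightarrow> real \<Rightarrow> real) \<Rightarrow> (nat \<Rightarrow> real \<Rightarrow> real) \<Rightarrow> nat \<Rightarrow> (real \<Rightarrow> real) \<Rightarrow> real \<Rightarrow> real" where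
  "intensity_left a p k X s = left_lim (\<lambda>r. intensity a p k (X r) r) s"

definition obs_algebra :: "'a set \<Rightarrow> nat \<Rightarrow> (nat \<Rightarrow> real \<Rightarrow> 'a \<Rightarrow> nat) \<Rightarrow> real \<Rightarrow> 'a measure" where
  "obs_algebra \<Omega> n Y t =
     generated \<Omega> ({1..n} \<times> {0..t}) (count_space UNIV) (\<lambda>(k, s). Y k s)"

definition admissible_controls ::
    "real \<Rightarrow> 'a measure \<Rightarrow> real set \<Rightarrow> nat \<Rightarrow> (nat \<Rightarrow> real \<Rightarrow> 'a \<Rightarrow> nat) \<Rightarrow> (real \<Rightarrow> 'a \<Rightarrow> real) set" where
  "admissible_controls T P U n Y =
     {u. (\<forall>t\<in>{0..T}. \<forall>\<omega>\<in>space P. u t \<omega> \<in> U) \<and>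
         predictable T (space P) (obs_algebra (space P) n Y) u \<and>
         (\<exists>p0>1. (\<integral>\<^sup>+\<omega>. (\<integral>\<^sup>+t\<in>{0..T}. ennreal (\<bar>u t \<omega>\<bar> powr (4 * p0)) \<partial>lborel) \<partial>P) < \<infinity>)}"

text \<open>
  The random measure and its compensated version generate the same sigma-algebra, since the
  compensator is deterministic.
\<close>

definition full_algebra ::
    "'a measure \<Rightarrow> 'e measure \<Rightarrow> (real \<Rightarrow> 'a \<Rightarrow> real) \<Rightarrow> ('a \<Rightarrow> (real \<times> 'e) measure) \<Rightarrow>
     nat \<Rightarrow> (nat \<Rightarrow> real \<Rightarrow> 'a \<Rightarrow> nat) \<Rightarrow> real \<Rightarrow> 'a measure" where
  "full_algebra P \<nu> W Nb n Y t = sigma (space P)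
     (sets (generated (space P) {0..t} borel W) \<union>
      sets (generated (space P) {A \<in> sets (prm_intensity \<nu>). A \<subseteq> {0..t} \<times> UNIV} borel
              (\<lambda>A \<omega>. emeasure (Nb \<omega>) A)) \<union>
      sets (obs_algebra (space P) n Y t) \<union>
      null_sets P)"

definition equivalent_on :: "'a measure \<Rightarrow> 'a measure \<Rightarrow> 'a measure \<Rightarrow> bool" where
  "equivalent_on G P Q \<longleftrightarrow>
     absolutely_continuous (restr_to_subalg P G) (restr_to_subalg Q G) \<and>
     absolutely_continuous (restr_to_subalg Q G) (restr_to_subalg P G)"

text \<open>Z is a (finite) version of dP/dQ on the sub-sigma-algebra G.\<close>

definition likelihood_ratio_on :: "'a measure \<Rightarrow> 'a measure \<Rightarrow> 'a measure \<Rightarrow> ('a \<Rightarrow> real) \<Rightarrow> bool" where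
  "likelihood_ratio_on G P Q Z \<longleftrightarrow>
     Z \<in> borel_measurable G \<and> (AE \<omega> in Q. 0 \<le> Z \<omega>) \<and>
     restr_to_subalg P G = density (restr_to_subalg Q G) (\<lambda>\<omega>. ennreal (Z \<omega>))"

text \<open>
  The equation dM(t) = sum_k (lambda_k(X(t-),t-) - 1) M(t-) d(Y_k(t) - t), M(0) = 1; its
  integrators have finite variation, so that the integrals are taken pathwise.
\<close>

definition likelihood_equation ::
    "real \<Rightarrow> 'a measure \<Rightarrow> (real \<Rightarrow> real \<Rightarrow> real) \<Rightarrow> (nat \<Rightarrow> real \<Rightarrow> real) \<Rightarrow> nat \<Rightarrow>
     (real \<Rightarrow> 'a \<Rightarrow> real) \<Rightarrow> (nat \<Rightarrow> real \<Rightarrow> 'a \<Rightarrow> nat) \<Rightarrow> (real \<Rightarrow> 'a \<Rightarrow> real) \<Rightarrow> bool" where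
  "likelihood_equation T Q a p n X Y M \<longleftrightarrow>
     (AE \<omega> in Q. cadlag_on T (\<lambda>t. M t \<omega>) \<and>
        (\<forall>t\<in>{0..T}.
           let h = (\<lambda>k s. (intensity_left a p k (\<lambda>r. X r \<omega>) s - 1) * left_lim (\<lambda>r. M r \<omega>) s)
           in M t \<omega> = 1 + (\<Sum>k=1..n.
                stieltjes_integral T (h k) (\<lambda>s. real (Y k s \<omega>)) t - (LINT s:{0..t}|lborel. h k s))))"

end

theory Submission
  imports Defs
begin

text \<open>
  Almost surely under Q no two observation processes jump together, so M solves a linear equation
  path by path: between jumps it grows or decays at a rate bounded by a constant C, and a jump of
  the k-th process multiplies it by the left limit of the k-th intensity, which lies in [1/D, D]
  by the bounds on a and p. Hence M(t) and 1/M(t) are at most exp(C t) D^S(t), where S counts all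
  jumps, and S(T) has exponential moments of all orders under Q. For the control, Young's
  inequality gives |u|^4 \<le> |u|^(4 p0) M(T) + M(T)^(-1/(p0-1)); M(T) turns the expectation of the
  first term under Q into one under P, and the second term is a moment of M(T).
\<close>

section \<open>Left limits and measurability of paths\<close>

text \<open>No product formula for M is derived: two inequalities per path are enough. The lower
  bound matters as much as the upper one because q may be negative, and since no sign of M along the
  whole path is known beforehand, everything is done for |M|. Common jumps have to be excluded: two
  at once would multiply M by lambda_j + lambda_k - 1, which may vanish. The second obstacle is
  regularity. The total intensity is merely measurable in time, so the intensity along a path may
  have no left limits, and \<open>left_lim\<close> then falls back to the value itself. The
  integrand must be shown to be measurable nevertheless, since splitting the integrals of the
  equation over adjacent intervals needs integrability. The drift, in turn, sees M only through its
  left limits, so continuity of M between jumps has to be proved before Gronwall's inequality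
  applies.\<close>

lemma left_limit_exists_iff_Cauchy:
  fixes f :: "real \<Rightarrow> real"
  shows "(\<exists>l. (f \<longlongrightarrow> l) (at_left s)) \<longleftrightarrow>
    (\<forall>j::nat. \<exists>i::nat. \<forall>r\<in>{s - 1 / Suc i<..<s}. \<forall>r'\<in>{s - 1 / Suc i<..<s}. \<bar>f r - f r'\<bar> \<le> 1 / Suc j)"
    (is "?L \<longleftrightarrow> ?R")
proof
  assume ?L
  then obtain l where l: "(f \<longlongrightarrow> l) (at_left s)" ..
  show ?R
  proof
    fix j :: nat
    have "eventually (\<lambda>r. dist (f r) l < 1 / (2 * Suc j)) (at_left s)"
      using tendstoD[OF l, of "1 / (2 * Suc j)"] by simp
    then obtain b where b: "b < s" "\<And>r. b < r \<Longrightarrow> r < s \<Longrightarrow> dist (f r) l < 1 / (2 * Suc j)"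
      by (auto simp: eventually_at_left[of "s - 1"])
    obtain i :: nat where i: "inverse (Suc i) < s - b"
      using reals_Archimedean[of "s - b"] b(1) by auto
    have *: "dist (f r) l < 1 / (2 * Suc j)" if "r \<in> {s - 1 / Suc i<..<s}" for r
      using that i by (intro b(2)) (auto simp: inverse_eq_divide)
    have "\<bar>f r - f r'\<bar> \<le> 1 / Suc j"
      if "r \<in> {s - 1 / Suc i<..<s}" "r' \<in> {s - 1 / Suc i<..<s}" for r r'
    proof -
      have "\<bar>f r - f r'\<bar> \<le> 1 / (2 * Suc j) + 1 / (2 * Suc j)"
        using *[OF that(1)] *[OF that(2)] unfolding dist_real_def by linarith
      also have "\<dots> = 1 / Suc j" by (simp add: field_simps)
      finally show ?thesis .
    qed
    then show "\<exists>i::nat. \<forall>r\<in>{s - 1 / Suc i<..<s}. \<forall>r'\<in>{s - 1 / Suc i<..<s}. \<bar>f r - f r'\<bar> \<le> 1 / Suc j"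
      by blast
  qed
next
  assume R: ?R
  have near: "\<forall>e>0. \<exists>\<delta>>0. \<forall>r\<in>{s - \<delta><..<s}. \<forall>r'\<in>{s - \<delta><..<s}. \<bar>f r - f r'\<bar> < e"
  proof (intro allI impI)
    fix e :: real assume "0 < e"
    then obtain j :: nat where j: "inverse (Suc j) < e" using reals_Archimedean by blast
    from R obtain i :: nat where
      "\<forall>r\<in>{s - 1 / Suc i<..<s}. \<forall>r'\<in>{s - 1 / Suc i<..<s}. \<bar>f r - f r'\<bar> \<le> 1 / Suc j" by blast
    then show "\<exists>\<delta>>0. \<forall>r\<in>{s - \<delta><..<s}. \<forall>r'\<in>{s - \<delta><..<s}. \<bar>f r - f r'\<bar> < e"
      using j by (intro exI[of _ "1 / Suc i"]) (force simp: inverse_eq_divide)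
  qed
  \<comment> \<open>The limit is found along one fixed sequence increasing to \<open>s\<close>;
    \<open>near\<close> makes the values Cauchy and then extends the convergence to all points left
    of \<open>s\<close>.\<close>
  define x where "x i = s - 1 / (real i + 1)" for i :: nat
  have x_lim: "x \<longlonglongrightarrow> s"
    unfolding x_def using tendsto_diff[OF tendsto_const LIMSEQ_inverse_real_of_nat, of s]
    by (simp add: inverse_eq_divide add.commute)
  have x_in: "eventually (\<lambda>i. x i \<in> {s - \<delta><..<s}) sequentially" if "0 < \<delta>" for \<delta>
    using order_tendstoD(1)[OF x_lim, of "s - \<delta>"] that
    by (auto elim!: eventually_mono simp: x_def)
  have "Cauchy (\<lambda>i. f (x i))"
  proof (rule metric_CauchyI)
    fix e :: real assume "0 < e"
    then obtain \<delta> where \<delta>: "\<delta> > 0" "\<And>r r'. r \<in> {s - \<delta><..<s} \<Longrightarrow> r' \<in> {s - \<delta><..<s} \<Longrightarrow> \<bar>f r - f r'\<bar> < e"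
      using near by metis
    from x_in[OF \<delta>(1)] obtain N where "\<And>i. i \<ge> N \<Longrightarrow> x i \<in> {s - \<delta><..<s}"
      unfolding eventually_sequentially by blast
    then show "\<exists>N. \<forall>m\<ge>N. \<forall>k\<ge>N. dist (f (x m)) (f (x k)) < e"
      using \<delta>(2) unfolding dist_real_def by blast
  qed
  then obtain l where l: "(\<lambda>i. f (x i)) \<longlonglongrightarrow> l"
    using Cauchy_convergent convergent_def by blast
  have "(f \<longlongrightarrow> l) (at_left s)"
  proof (rule tendstoI)
    fix e :: real assume e: "0 < e"
    then obtain \<delta> where \<delta>: "\<delta> > 0" "\<And>r r'. r \<in> {s - \<delta><..<s} \<Longrightarrow> r' \<in> {s - \<delta><..<s} \<Longrightarrow> \<bar>f r - f r'\<bar> < e/2"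
      using near half_gt_zero by metis
    have "eventually (\<lambda>i. x i \<in> {s - \<delta><..<s} \<and> dist (f (x i)) l < e/2) sequentially"
      using x_in[OF \<delta>(1)] tendstoD[OF l, of "e/2"] e by (intro eventually_conj) auto
    then obtain i where i: "x i \<in> {s - \<delta><..<s}" "dist (f (x i)) l < e/2"
      by (auto dest: eventually_happens)
    have "dist (f r) l < e" if "r \<in> {s - \<delta><..<s}" for r
      using \<delta>(2)[OF that i(1)] i(2) unfolding dist_real_def by linarith
    then show "eventually (\<lambda>r. dist (f r) l < e) (at_left s)"
      using \<delta>(1) by (auto simp: eventually_at_left[of "s - 1"] intro!: exI[of _ "s - \<delta>"])
  qed
  then show ?L ..
qed

text \<open>The points where f oscillates by more than a given amount immediately to the left form an
  open set, whatever f is; hence no measurability of f is needed.\<close>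

lemma left_limit_exists_borel:
  fixes f :: "real \<Rightarrow> real"
  shows "{s. \<exists>l. (f \<longlongrightarrow> l) (at_left s)} \<in> sets borel"
proof -
  define V where "V i j = {s. \<exists>r\<in>{s - 1 / Suc i<..<s}. \<exists>r'\<in>{s - 1 / Suc i<..<s}. 1 / Suc j < \<bar>f r - f r'\<bar>}"
    for i j :: nat
  \<comment> \<open>For a fixed pair \<open>r\<close>, \<open>r'\<close> of oscillating values, the
    points \<open>s\<close> that see both within distance \<open>1 / Suc i\<close> on their left
    form an intersection of two open intervals.\<close>
  have "V i j = (\<Union>(r, r')\<in>{(r, r'). 1 / Suc j < \<bar>f r - f r'\<bar>}. {r<..<r + 1 / Suc i} \<inter> {r'<..<r' + 1 / Suc i})"
    for i j by (auto simp: V_def algebra_simps; force simp: algebra_simps)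
  then have "open (V i j)" for i j
    by (auto intro!: open_UN)
  then have [measurable]: "V i j \<in> sets borel" for i j by auto
  \<comment> \<open>The Cauchy criterion quantifies over natural numbers only, so countable set
    operations suffice.\<close>
  have "{s. \<exists>l. (f \<longlongrightarrow> l) (at_left s)} = (\<Inter>j. \<Union>i. - V i j)"
    unfolding left_limit_exists_iff_Cauchy V_def by (auto simp: not_less)
  then show ?thesis by auto
qed

lemma filterlim_minus_inverse_at_left:
  "filterlim (\<lambda>i::nat. s - 1 / (real i + 1)) (at_left s) sequentially"
proof (rule filterlim_at_withinI)
  show "filterlim (\<lambda>i::nat. s - 1 / (real i + 1)) (nhds s) sequentially"
    using tendsto_diff[OF tendsto_const LIMSEQ_inverse_real_of_nat, of s]
    by (simp add: inverse_eq_divide add.commute)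
qed (auto intro!: always_eventually simp: less_diff_eq)

lemma left_lim_eqI:
  assumes "(f \<longlongrightarrow> l) (at_left s)" "0 < s"
  shows "left_lim f s = l"
  using assms tendsto_Lim[OF _ assms(1)] by (auto simp: left_lim_def)

text \<open>On the Borel set \<open>E\<close> where the left limit exists it is the limit along
  \<open>s - 1 / (i + 1)\<close>; off \<open>E\<close> the convention gives \<open>f\<close> itself.
  Both are pointwise limits of measurable functions, with \<open>f\<close> extended by 0.\<close>

lemma left_lim_measurable:
  assumes f: "f \<in> borel_measurable (restrict_space borel {0..T})"
  shows "left_lim f \<in> borel_measurable (restrict_space borel {0..T})"
proof -
  define f0 where "f0 s = indicator {0..T} s *\<^sub>R f s" for s :: real
  have [measurable]: "f0 \<in> borel_measurable borel"
    using f unfolding f0_def by (subst (asm) borel_measurable_restrict_space_iff) auto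
  define E where "E = {s. \<exists>l. (f \<longlongrightarrow> l) (at_left s)} \<inter> {0<..}"
  have [measurable]: "E \<in> sets borel"
    unfolding E_def using left_limit_exists_borel by auto
  have "(\<lambda>s. indicator {0..T} s *\<^sub>R left_lim f s) \<in> borel_measurable borel"
  proof (rule borel_measurable_LIMSEQ_real)
    fix s :: real
    show "(\<lambda>i. indicator {0..T} s * (if s \<in> E then f0 (s - 1 / (real i + 1)) else f0 s))
      \<longlonglongrightarrow> indicator {0..T} s *\<^sub>R left_lim f s"
    proof (cases "s \<in> {0..T}")
      case sT: True
      show ?thesis
      proof (cases "s \<in> E")
        case True
        then obtain l where l: "(f \<longlongrightarrow> l) (at_left s)" "0 < s" by (auto simp: E_def)
        have "eventually (\<lambda>r. f r = f0 r) (at_left s)"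
          using sT l(2) by (auto simp: eventually_at_left[of 0] f0_def intro!: exI[of _ 0])
        then have "(f0 \<longlongrightarrow> l) (at_left s)"
          using tendsto_cong l(1) by blast
        from filterlim_compose[OF this filterlim_minus_inverse_at_left]
        show ?thesis using True sT left_lim_eqI[OF l] by simp
      next
        case False
        then have "left_lim f s = f s" by (auto simp: left_lim_def E_def)
        then show ?thesis using False sT by (simp add: f0_def)
      qed
    qed simp
  qed measurable
  then show ?thesis
    by (subst borel_measurable_restrict_space_iff) auto
qed

text \<open>A closed interval survives both branches of \<open>left_lim\<close>, so bounds on the
  intensities carry over whether or not left limits exist.\<close>

lemma left_lim_bounds:
  assumes f: "\<And>r. r \<in> {0..T} \<Longrightarrow> f r \<in> {lo..hi}" and s: "s \<in> {0..T}"
  shows "left_lim f s \<in> {lo..hi}"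
proof (cases "0 < s \<and> (\<exists>l. (f \<longlongrightarrow> l) (at_left s))")
  case True
  then obtain l where l: "(f \<longlongrightarrow> l) (at_left s)" "0 < s" by auto
  have "eventually (\<lambda>r. f r \<in> {lo..hi}) (at_left s)"
    using l(2) s f by (auto simp: eventually_at_left[of 0] simp del: atLeastAtMost_iff intro!: exI[of _ 0]) auto
  then have "l \<in> {lo..hi}"
    using tendsto_lowerbound[OF l(1)] tendsto_upperbound[OF l(1)]
    by (auto simp: eventually_conj_iff)
  then show ?thesis using left_lim_eqI[OF l] by simp
next
  case False
  then have "left_lim f s = f s" by (auto simp: left_lim_def)
  then show ?thesis using f[OF s] by simp
qed

text \<open>By right-continuity, \<open>f\<close> is the limit of its values at the next grid point
  strictly to the right. The endpoint \<open>T\<close>, where nothing lies to the right, is treated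
  separately.\<close>

lemma cadlag_on_measurable:
  assumes "cadlag_on T f"
  shows "f \<in> borel_measurable (restrict_space borel {0..T})"
proof -
  define x where "x i s = min T ((real_of_int \<lfloor>s * (real i + 1)\<rfloor> + 1) / (real i + 1))" for i :: nat and s
  \<comment> \<open>The dependence on \<open>s\<close> is through an integer floor only, so this
    holds for any \<open>f\<close>.\<close>
  have x_meas: "(\<lambda>s. f (x i s)) \<in> borel_measurable borel" for i
    unfolding x_def by (rule measurable_compose[where N="count_space UNIV"]) auto
  have "(\<lambda>s. indicator {0..T} s *\<^sub>R f s) \<in> borel_measurable borel"
  proof (rule borel_measurable_LIMSEQ_real)
    fix s :: real
    show "(\<lambda>i. indicator {0..T} s * (if s = T then f T else f (x i s))) \<longlonglongrightarrow> indicator {0..T} s *\<^sub>R f s"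
    proof (cases "s \<in> {0..<T}")
      case True
      then have cont: "(f \<longlongrightarrow> f s) (at_right s)"
        using assms by (auto simp: cadlag_on_def continuous_within)
      have lo: "s < (real_of_int \<lfloor>s * (real i + 1)\<rfloor> + 1) / (real i + 1)" for i :: nat
        by (simp add: less_divide_eq)
      have hi: "(real_of_int \<lfloor>s * (real i + 1)\<rfloor> + 1) / (real i + 1) \<le> s + 1 / (real i + 1)" for i :: nat
        by (simp add: divide_le_eq add_divide_eq_iff)
      have "(\<lambda>i. x i s) \<longlonglongrightarrow> s"
      proof (rule tendsto_sandwich)
        show "eventually (\<lambda>i. s \<le> x i s) sequentially"
          using lo True by (auto simp: x_def less_imp_le)
        show "eventually (\<lambda>i. x i s \<le> s + 1 / (real i + 1)) sequentially"
          using hi by (auto simp: x_def min_le_iff_disj)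
        show "(\<lambda>i. s + 1 / (real i + 1)) \<longlonglongrightarrow> s"
          using tendsto_add[OF tendsto_const LIMSEQ_inverse_real_of_nat, of s]
          by (simp add: inverse_eq_divide add.commute)
      qed simp
      moreover have "s < x i s" for i using lo[of i] True by (simp add: x_def)
      ultimately have "filterlim (\<lambda>i. x i s) (at_right s) sequentially"
        by (intro filterlim_at_withinI) (auto intro!: always_eventually simp: less_imp_neq[symmetric])
      from filterlim_compose[OF cont this] show ?thesis using True by simp
    next
      case False
      then show ?thesis by (cases "s = T") auto
    qed
  qed (use x_meas in measurable)
  then show ?thesis
    by (subst borel_measurable_restrict_space_iff) auto
qed

text \<open>One-sided limits bound \<open>f\<close> near each point, and Bolzano's bisection
  principle glues the local bounds. The restriction to times in [0,T] inside the predicate makes the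
  outer side of each endpoint vacuous.\<close>

lemma cadlag_on_bounded:
  assumes cad: "cadlag_on T f" and "0 \<le> T"
  shows "\<exists>B. \<forall>t\<in>{0..T}. \<bar>f t\<bar> \<le> B"
proof -
  have "\<exists>B. \<forall>t\<in>{0..T}. 0 \<le> t \<and> t \<le> T \<longrightarrow> \<bar>f t\<bar> \<le> B"
    using \<open>0 \<le> T\<close>
  proof (induction rule: Bolzano[where P="\<lambda>a b. \<exists>B. \<forall>t\<in>{a..b}. 0 \<le> t \<and> t \<le> T \<longrightarrow> \<bar>f t\<bar> \<le> B"])
    case (trans a b c)
    then obtain B1 B2 where
      "\<forall>t\<in>{a..b}. 0 \<le> t \<and> t \<le> T \<longrightarrow> \<bar>f t\<bar> \<le> B1" "\<forall>t\<in>{b..c}. 0 \<le> t \<and> t \<le> T \<longrightarrow> \<bar>f t\<bar> \<le> B2" by blast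
    then have "\<bar>f t\<bar> \<le> max B1 B2" if "t \<in> {a..c}" "0 \<le> t" "t \<le> T" for t
      using that by (cases "t \<le> b") (auto simp: le_max_iff_disj)
    then show ?case by blast
  next
    case (local x)
    have lim_bd: "\<exists>B. eventually (\<lambda>r. \<bar>f r\<bar> \<le> B) F" if "(f \<longlongrightarrow> l) F" for l and F :: "real filter"
      using tendstoD[OF that, of 1]
      by (intro exI[of _ "\<bar>l\<bar> + 1"]) (auto elim!: eventually_mono simp: dist_real_def)
    have L: "\<exists>B. eventually (\<lambda>r. 0 \<le> r \<longrightarrow> \<bar>f r\<bar> \<le> B) (at_left x)"
    proof (cases "x = 0")
      case True
      then show ?thesis by (auto simp: eventually_at_left[of "-1"] intro!: exI[of _ "-1"])
    next
      case False
      then obtain l where "(f \<longlongrightarrow> l) (at_left x)" using cad local by (force simp: cadlag_on_def)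
      from lim_bd[OF this] show ?thesis by (auto elim!: eventually_mono)
    qed
    have R: "\<exists>B. eventually (\<lambda>r. r \<le> T \<longrightarrow> \<bar>f r\<bar> \<le> B) (at_right x)"
    proof (cases "x = T")
      case True
      then show ?thesis by (auto simp: eventually_at_right[of _ "T+1"] intro!: exI[of _ "T+1"])
    next
      case False
      then have "(f \<longlongrightarrow> f x) (at_right x)"
        using cad local by (auto simp: cadlag_on_def continuous_within)
      from lim_bd[OF this] show ?thesis by (auto elim!: eventually_mono)
    qed
    from L obtain B1 d1 where 1: "d1 < x" "\<And>r. d1 < r \<Longrightarrow> r < x \<Longrightarrow> 0 \<le> r \<Longrightarrow> \<bar>f r\<bar> \<le> B1"
      by (auto simp: eventually_at_left[of "x - 1"])
    from R obtain B2 d2 where 2: "x < d2" "\<And>r. x < r \<Longrightarrow> r < d2 \<Longrightarrow> r \<le> T \<Longrightarrow> \<bar>f r\<bar> \<le> B2"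
      by (auto simp: eventually_at_right[of _ "x + 1"])
    have bd: "\<bar>f r\<bar> \<le> max (max B1 B2) \<bar>f x\<bar>" if "d1 < r" "r < d2" "0 \<le> r" "r \<le> T" for r
      using 1(2)[of r] 2(2)[of r] that by (cases r x rule: linorder_cases) auto
    show ?case
      using 1(1) 2(1)
      by (intro exI[of _ "min (x - d1) (d2 - x)"] conjI allI impI exI[of _ "max (max B1 B2) \<bar>f x\<bar>"])
        (auto intro!: bd)
  qed
  then show ?thesis by auto
qed

section \<open>The pathwise two-sided bound\<close>

text \<open>Because the hypothesis bounds the absolute increment, time can be run in either
  direction. With \<open>I\<close> the primitive of |f|,
  \<open>(\<bar>f a\<bar> + C * I r) * exp (- C * r)\<close> is nonincreasing and
  \<open>(\<bar>f b\<bar> + C * (I b - I r)) * exp (C * r)\<close> is nondecreasing. The backward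
  estimate is what will keep M away from 0.\<close>

lemma gronwall_two_sided:
  fixes f :: "real \<Rightarrow> real"
  assumes "a \<le> b" "0 \<le> C" and cont: "continuous_on {a..b} f"
    and incr: "\<And>s r. a \<le> s \<Longrightarrow> s \<le> r \<Longrightarrow> r \<le> b \<Longrightarrow> \<bar>f r - f s\<bar> \<le> C * integral {s..r} (\<lambda>u. \<bar>f u\<bar>)"
  shows "\<bar>f b\<bar> \<le> \<bar>f a\<bar> * exp (C * (b - a))" and "\<bar>f a\<bar> \<le> \<bar>f b\<bar> * exp (C * (b - a))"
proof -
  define I where "I r = integral {a..r} (\<lambda>u. \<bar>f u\<bar>)" for r
  have contf: "continuous_on {a..b} (\<lambda>u. \<bar>f u\<bar>)" using cont by (intro continuous_intros)
  have I_deriv: "(I has_real_derivative \<bar>f r\<bar>) (at r within {a..b})" if "r \<in> {a..b}" for r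
    unfolding I_def using integral_has_real_derivative[OF contf that] .
  have I_diff: "integral {r..b} (\<lambda>u. \<bar>f u\<bar>) = I b - I r" if "r \<in> {a..b}" for r
    unfolding I_def using Henstock_Kurzweil_Integration.integral_combine[of a r b "\<lambda>u. \<bar>f u\<bar>"] that
      integrable_continuous_interval[OF contf] by auto
  have deriv_mono: "G a \<le> G b"
    if "\<And>r. r \<in> {a..b} \<Longrightarrow> \<exists>g\<ge>0. (G has_real_derivative g) (at r within {a..b})" for G :: "real \<Rightarrow> real"
  proof -
    have "continuous_on {a..b} G"
      using that DERIV_continuous by (metis continuous_on_eq_continuous_within)
    moreover have "\<exists>g. (G has_real_derivative g) (at r) \<and> g \<ge> 0" if "a < r" "r < b" for r
      using \<open>\<And>r. r \<in> {a..b} \<Longrightarrow> \<exists>g\<ge>0. _ r g\<close>[of r] that at_within_interior[of r "{a..b}"] by auto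
    ultimately show ?thesis
      using \<open>a \<le> b\<close> DERIV_nonneg_imp_increasing_open[of a b G] by auto
  qed
  have "- ((\<bar>f a\<bar> + C * I a) * exp (- C * a)) \<le> - ((\<bar>f a\<bar> + C * I b) * exp (- C * b))"
  proof (rule deriv_mono)
    fix r assume r: "r \<in> {a..b}"
    have "\<bar>f r\<bar> \<le> \<bar>f a\<bar> + C * I r"
      using incr[of a r] r unfolding I_def by auto
    then have "0 \<le> C * (\<bar>f a\<bar> + C * I r - \<bar>f r\<bar>) * exp (- C * r)"
      using \<open>0 \<le> C\<close> by simp
    moreover have "((\<lambda>r. - ((\<bar>f a\<bar> + C * I r) * exp (- C * r))) has_real_derivative
        C * (\<bar>f a\<bar> + C * I r - \<bar>f r\<bar>) * exp (- C * r)) (at r within {a..b})"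
      by (auto intro!: derivative_eq_intros I_deriv[OF r] simp: algebra_simps)
    ultimately show "\<exists>g\<ge>0. ((\<lambda>r. - ((\<bar>f a\<bar> + C * I r) * exp (- C * r))) has_real_derivative g) (at r within {a..b})"
      by blast
  qed
  then have "(\<bar>f a\<bar> + C * I b) * exp (- C * b) * exp (C * b) \<le> \<bar>f a\<bar> * exp (- C * a) * exp (C * b)"
    by (intro mult_right_mono) (auto simp: I_def)
  then have "\<bar>f a\<bar> + C * I b \<le> \<bar>f a\<bar> * exp (C * (b - a))"
    by (simp add: mult.assoc flip: exp_add) (simp add: algebra_simps)
  then show "\<bar>f b\<bar> \<le> \<bar>f a\<bar> * exp (C * (b - a))"
    using incr[of a b] \<open>a \<le> b\<close> unfolding I_def by auto
  have "(\<bar>f b\<bar> + C * (I b - I a)) * exp (C * a) \<le> (\<bar>f b\<bar> + C * (I b - I b)) * exp (C * b)"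
  proof (rule deriv_mono)
    fix r assume r: "r \<in> {a..b}"
    have "\<bar>f r\<bar> \<le> \<bar>f b\<bar> + C * (I b - I r)"
      using incr[of r b] r I_diff[OF r] by auto
    then have "0 \<le> C * (\<bar>f b\<bar> + C * (I b - I r) - \<bar>f r\<bar>) * exp (C * r)"
      using \<open>0 \<le> C\<close> by simp
    moreover have "((\<lambda>r. (\<bar>f b\<bar> + C * (I b - I r)) * exp (C * r)) has_real_derivative
        C * (\<bar>f b\<bar> + C * (I b - I r) - \<bar>f r\<bar>) * exp (C * r)) (at r within {a..b})"
      by (auto intro!: derivative_eq_intros I_deriv[OF r] simp: algebra_simps)
    ultimately show "\<exists>g\<ge>0. ((\<lambda>r. (\<bar>f b\<bar> + C * (I b - I r)) * exp (C * r)) has_real_derivative g) (at r within {a..b})"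
      by blast
  qed
  then have "(\<bar>f b\<bar> + C * (I b - I a)) * exp (C * a) * exp (- C * a) \<le> \<bar>f b\<bar> * exp (C * b) * exp (- C * a)"
    by (intro mult_right_mono) auto
  then have "\<bar>f b\<bar> + C * (I b - I a) \<le> \<bar>f b\<bar> * exp (C * (b - a))"
    by (simp add: mult.assoc flip: exp_add) (simp add: algebra_simps)
  then show "\<bar>f a\<bar> \<le> \<bar>f b\<bar> * exp (C * (b - a))"
    using incr[of a b] \<open>a \<le> b\<close> I_diff[of a] by auto
qed

text \<open>In the discrete space of natural numbers a convergent function is eventually constant,
  so the one-sided limits of a counting path become plateaus.\<close>

lemma counting_path_left:
  assumes y: "counting_path {0..T} y" and \<tau>: "0 < \<tau>" "\<tau> \<le> T"
  obtains s l where "0 \<le> s" "s < \<tau>" "\<And>u. s \<le> u \<Longrightarrow> u < \<tau> \<Longrightarrow> y u = l" "l \<le> y \<tau>" "y \<tau> \<le> l + 1"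
proof -
  from y \<tau> obtain l where l: "(y \<longlongrightarrow> l) (at \<tau> within {..<\<tau>} \<inter> {0..T})" "y \<tau> \<le> l + 1"
    unfolding counting_path_def by fastforce
  have "eventually (\<lambda>u. y u = l) (at \<tau> within {..<\<tau>} \<inter> {0..T})"
    using l(1) by (simp add: tendsto_discrete)
  then obtain d where d: "d > 0" "\<And>u. 0 \<le> u \<Longrightarrow> u < \<tau> \<Longrightarrow> \<bar>u - \<tau>\<bar> < d \<Longrightarrow> y u = l"
    unfolding eventually_at using \<tau> by (auto simp: dist_real_def)
  define s where "s = max 0 (\<tau> - d / 2)"
  have s: "0 \<le> s" "s < \<tau>" using d(1) \<tau> by (auto simp: s_def)
  have c: "y u = l" if "s \<le> u" "u < \<tau>" for u
    using that d(1) by (intro d(2)) (auto simp: s_def)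
  have "y s \<le> y \<tau>"
    using y s \<tau> unfolding counting_path_def by (auto intro: mono_onD)
  then show ?thesis using that[of s l] s c l(2) by auto
qed

lemma counting_path_right:
  assumes y: "counting_path {0..T} y" and t: "t \<in> {0..T}"
  obtains d where "0 < d" "\<And>u. t \<le> u \<Longrightarrow> u < t + d \<Longrightarrow> u \<le> T \<Longrightarrow> y u = y t"
proof -
  from y t have "(y \<longlongrightarrow> y t) (at t within {t..} \<inter> {0..T})"
    unfolding counting_path_def continuous_within by blast
  then have "eventually (\<lambda>u. y u = y t) (at t within {t..} \<inter> {0..T})"
    by (simp add: tendsto_discrete)
  then obtain d where d: "d > 0" "\<And>u. t < u \<Longrightarrow> u \<le> T \<Longrightarrow> u - t < d \<Longrightarrow> y u = y t"
    unfolding eventually_at using t by (force simp: dist_real_def)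
  show ?thesis
  proof (rule that[OF d(1)])
    fix u assume "t \<le> u" "u < t + d" "u \<le> T"
    then show "y u = y t" using d(2)[of u] by (cases "u = t") auto
  qed
qed

text \<open>The deterministic core: one outcome is fixed, \<open>g k\<close> stands for the left
  limits of the k-th intensity and \<open>m\<close> for the path of M. By monotonicity, equality of
  \<open>y j\<close> at \<open>s\<close> and \<open>t\<close> means constancy on [s,t], so
  \<open>no_common_jump\<close> says that of two paths at least one does not jump at
  \<open>t\<close>.\<close>

locale likelihood_path =
  fixes T c K :: real and n :: nat and y :: "nat \<Rightarrow> real \<Rightarrow> nat"
    and g :: "nat \<Rightarrow> real \<Rightarrow> real" and m :: "real \<Rightarrow> real"
  assumes T: "0 < T" and c: "0 < c"
    and paths: "\<And>k. k \<in> {1..n} \<Longrightarrow> counting_path {0..T} (y k)"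
    and no_common_jump: "\<And>j k t. j \<in> {1..n} \<Longrightarrow> k \<in> {1..n} \<Longrightarrow> j \<noteq> k \<Longrightarrow> t \<in> {0<..T} \<Longrightarrow>
      \<exists>s\<in>{0..<t}. y j s = y j t \<or> y k s = y k t"
    and g_meas: "\<And>k. k \<in> {1..n} \<Longrightarrow> g k \<in> borel_measurable (restrict_space borel {0..T})"
    and g_bounds: "\<And>k t. k \<in> {1..n} \<Longrightarrow> t \<in> {0..T} \<Longrightarrow> c \<le> g k t \<and> g k t \<le> K"
    and cadlag: "cadlag_on T m"
    and equation: "\<And>t. t \<in> {0..T} \<Longrightarrow> m t = 1 + (\<Sum>k=1..n.
      stieltjes_integral T (\<lambda>s. (g k s - 1) * left_lim m s) (\<lambda>s. real (y k s)) t
      - (LINT s:{0..t}|lborel. (g k s - 1) * left_lim m s))"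
begin

definition h :: "nat \<Rightarrow> real \<Rightarrow> real" where "h k s = (g k s - 1) * left_lim m s"

text \<open>For a counting path this is the sum of unit point masses at its jump times in (0,T]. The
  constant extension is the one in \<open>stieltjes_integral\<close>, so that the two match on
  unfolding.\<close>

definition jump_measure :: "nat \<Rightarrow> real measure" where
  "jump_measure k = interval_measure (\<lambda>s. real (y k (max 0 (min s T))))"

definition total :: "real \<Rightarrow> nat" where "total t = (\<Sum>k=1..n. y k t)"

text \<open>Dominates a jump factor in [c,K] as well as its reciprocal; being at least 1, it has
  nondecreasing powers.\<close>

definition D :: real where "D = max 1 (max K (1 / c))"

text \<open>From c > 0 and the bounds on \<open>g k\<close>, |g k - 1| is at most |K| + 1; there are
  \<open>n\<close> such terms in the drift.\<close>

definition C :: real where "C = real n * (\<bar>K\<bar> + 1)"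

definition R :: "real \<Rightarrow> real" where "R t = exp (C * t) * D ^ total t"

lemma sets_jump_measure [simp, measurable_cong]: "sets (jump_measure k) = sets borel"
  by (simp add: jump_measure_def)

lemma space_jump_measure [simp]: "space (jump_measure k) = UNIV"
  by (simp add: jump_measure_def)

lemma y_mono: "k \<in> {1..n} \<Longrightarrow> 0 \<le> s \<Longrightarrow> s \<le> t \<Longrightarrow> t \<le> T \<Longrightarrow> y k s \<le> y k t"
  using paths[of k] unfolding counting_path_def by (auto intro: mono_onD[of "{0..T}"])

lemma total_mono: "0 \<le> s \<Longrightarrow> s \<le> t \<Longrightarrow> t \<le> T \<Longrightarrow> total s \<le> total t"
  unfolding total_def by (intro sum_mono y_mono) auto

text \<open>All summands are nondecreasing, so none can grow while the sum stays the same.\<close>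

lemma y_eq_of_total_eq:
  assumes "0 \<le> s" "s \<le> t" "t \<le> T" "total s = total t" "k \<in> {1..n}"
  shows "y k s = y k t"
proof (rule ccontr)
  assume "y k s \<noteq> y k t"
  with y_mono[of k s t] assms have "y k s < y k t" by auto
  then have "total s < total t"
    unfolding total_def using assms by (intro sum_strict_mono_ex1) (auto intro: y_mono)
  with assms show False by simp
qed

lemma emeasure_jump_measure:
  assumes k: "k \<in> {1..n}" and st: "0 \<le> s" "s \<le> t" "t \<le> T"
  shows "emeasure (jump_measure k) {s<..t} = ennreal (real (y k t) - real (y k s))"
proof -
  let ?F = "\<lambda>s. real (y k (max 0 (min s T)))"
  have "emeasure (interval_measure ?F) {s<..t} = ennreal (?F t - ?F s)"
  proof (rule emeasure_interval_measure_Ioc)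
    show "?F u \<le> ?F v" if "u \<le> v" for u v
      using that T by (auto intro!: y_mono[OF k])
    show "continuous (at_right u) ?F" for u
    proof -
      define t' where "t' = max 0 (min u T)"
      have "t' \<in> {0..T}" using T by (auto simp: t'_def)
      from counting_path_right[OF paths[OF k] this] obtain d where
        d: "0 < d" "\<And>v. t' \<le> v \<Longrightarrow> v < t' + d \<Longrightarrow> v \<le> T \<Longrightarrow> y k v = y k t'" by blast
      have "eventually (\<lambda>v. ?F v = ?F u) (at_right u)"
        unfolding eventually_at_right[OF less_add_one]
        using d(1) T by (intro exI[of _ "u + d"]) (auto simp flip: t'_def intro!: d(2), auto simp: t'_def)
      then show ?thesis unfolding continuous_within by (rule tendsto_eventually)
    qed
  qed (use st in auto)
  then show ?thesis using st T by (simp add: jump_measure_def)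
qed

text \<open>A crude bound depending on the path. It serves integrability and the a priori continuity
  of \<open>m\<close>, and does not enter the final constants.\<close>

lemma left_lim_m_bounded: "\<exists>B\<ge>0. \<forall>t\<in>{0..T}. \<bar>m t\<bar> \<le> B \<and> \<bar>left_lim m t\<bar> \<le> B"
proof -
  obtain B where B: "\<And>t. t \<in> {0..T} \<Longrightarrow> \<bar>m t\<bar> \<le> B"
    using cadlag_on_bounded[OF cadlag] T by (meson less_imp_le)
  then have "left_lim m t \<in> {-B..B}" if "t \<in> {0..T}" for t
    using that by (intro left_lim_bounds) (auto simp: abs_le_iff minus_le_iff)
  then show ?thesis using B T
    by (intro exI[of _ B]) (fastforce simp: abs_le_iff)
qed

lemma h_bound:
  assumes "k \<in> {1..n}" "t \<in> {0..T}"
  shows "\<bar>h k t\<bar> \<le> (\<bar>K\<bar> + 1) * \<bar>left_lim m t\<bar>"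
  using g_bounds[OF assms] c unfolding h_def abs_mult by (intro mult_right_mono) auto

lemma h_meas:
  assumes "k \<in> {1..n}" shows "(\<lambda>s. indicator {0..T} s *\<^sub>R h k s) \<in> borel_measurable borel"
  using borel_measurable_times[OF borel_measurable_diff[OF g_meas[OF assms] borel_measurable_const]
      left_lim_measurable[OF cadlag_on_measurable[OF cadlag]], of 1]
  by (subst (asm) borel_measurable_restrict_space_iff) (auto simp: h_def)

lemma h_integrable:
  assumes k: "k \<in> {1..n}" and A: "A \<subseteq> {0..T}" "A \<in> sets borel"
    and \<mu>: "sets \<mu> = sets borel" "emeasure \<mu> A < \<infinity>"
  shows "set_integrable \<mu> A (h k)"
proof -
  obtain B where B: "B \<ge> 0" "\<And>t. t \<in> {0..T} \<Longrightarrow> \<bar>left_lim m t\<bar> \<le> B" using left_lim_m_bounded by blast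
  have eq: "indicator A s *\<^sub>R h k s = indicator A s *\<^sub>R (indicator {0..T} s *\<^sub>R h k s)" for s
    using A(1) by (auto simp: indicator_def)
  have "0 \<le> (\<bar>K\<bar> + 1) * B" using B(1) by simp
  moreover have "\<bar>h k s\<bar> \<le> (\<bar>K\<bar> + 1) * B" if "s \<in> A" for s
    using order_trans[OF h_bound[OF k] mult_left_mono[OF B(2)]] that A(1) by auto
  ultimately show ?thesis
    unfolding set_integrable_def eq
    using A \<mu> h_meas[OF k]
    by (intro integrableI_bounded_set_indicator[where B="(\<bar>K\<bar> + 1) * B"])
      (auto simp: indicator_def cong: measurable_cong_sets)
qed

lemma increment:
  assumes st: "0 \<le> s" "s \<le> t" "t \<le> T"
  shows "m t - m s = (\<Sum>k=1..n. (LINT u:{s<..t}|jump_measure k. h k u) - (LINT u:{s<..t}|lborel. h k u))"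
proof -
  have 1: "stieltjes_integral T (h k) (\<lambda>s. real (y k s)) t - stieltjes_integral T (h k) (\<lambda>s. real (y k s)) s
    = (LINT u:{s<..t}|jump_measure k. h k u)" if k: "k \<in> {1..n}" for k
  proof -
    have "{0<..t} = {0<..s} \<union> {s<..t}" using st by auto
    moreover have "set_integrable (jump_measure k) {0<..s} (h k)" "set_integrable (jump_measure k) {s<..t} (h k)"
      using st by (auto intro!: h_integrable[OF k] simp: emeasure_jump_measure[OF k])
    ultimately show ?thesis
      unfolding stieltjes_integral_def jump_measure_def[symmetric]
      by (simp add: set_integral_Un)
  qed
  have 2: "(LINT u:{0..t}|lborel. h k u) - (LINT u:{0..s}|lborel. h k u) = (LINT u:{s<..t}|lborel. h k u)"
    if k: "k \<in> {1..n}" for k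
  proof -
    have "{0..t} = {0..s} \<union> {s<..t}" using st by auto
    moreover have "set_integrable lborel {0..s} (h k)" "set_integrable lborel {s<..t} (h k)"
      using st by (auto intro!: h_integrable[OF k])
    moreover have "{0..s} \<inter> {s<..t} = {}" by auto
    ultimately show ?thesis by (simp add: set_integral_Un)
  qed
  have eq: "m v = 1 + (\<Sum>k=1..n. stieltjes_integral T (h k) (\<lambda>s. real (y k s)) v - (LINT u:{0..v}|lborel. h k u))"
    if "v \<in> {0..T}" for v
    using equation[OF that] unfolding h_def[abs_def] .
  show ?thesis
    using st 
    by (subst (1 2) eq) (auto simp flip: sum_subtractf 1 2 intro!: sum.cong)
qed

lemma jump_integral_zero:
  assumes k: "k \<in> {1..n}" and st: "0 \<le> s" "s \<le> t" "t \<le> T" and eq: "y k s = y k t"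
  shows "(LINT u:{s<..t}|jump_measure k. h k u) = 0"
proof -
  have "{s<..t} \<in> null_sets (jump_measure k)"
    using emeasure_jump_measure[OF k st] eq by (intro null_setsI) auto
  then have "AE u in jump_measure k. indicator {s<..t} u *\<^sub>R h k u = 0"
    by (auto dest!: AE_not_in elim!: eventually_mono)
  then show ?thesis unfolding set_lebesgue_integral_def by (rule integral_eq_zero_AE)
qed

text \<open>The measure has total mass 1 on \<open>{s<..\<tau>}\<close> and none on the open
  interval before \<tau>, so it acts there as the point mass at \<tau>.\<close>

lemma jump_integral_unit:
  assumes k: "k \<in> {1..n}" and s: "0 \<le> s" "s < \<tau>" "\<tau> \<le> T"
    and jump: "\<And>u. s \<le> u \<Longrightarrow> u < \<tau> \<Longrightarrow> y k u + 1 = y k \<tau>"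
  shows "(LINT u:{s<..\<tau>}|jump_measure k. h k u) = h k \<tau>"
proof -
  \<comment> \<open>The masses of left-open, right-closed intervals are the ones known, so the open
    interval is exhausted by \<open>{s<..x i}\<close>.\<close>
  define x where "x i = \<tau> - (\<tau> - s) / (real i + 1)" for i :: nat
  have "(\<tau> - s) / (real i + 1) \<le> (\<tau> - s) / 1" for i
    using s by (intro divide_left_mono) auto
  then have x: "s \<le> x i" "x i < \<tau>" for i
    using s by (auto simp: x_def le_diff_eq diff_le_eq) (smt (verit))
  have "{s<..x i} \<in> null_sets (jump_measure k)" for i
    using emeasure_jump_measure[OF k s(1) x(1)] x[of i] s jump[of s] jump[of "x i"]
    by (intro null_setsI) auto
  then have "(\<Union>i. {s<..x i}) \<in> null_sets (jump_measure k)" by blast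
  moreover have "(\<Union>i. {s<..x i}) = {s<..<\<tau>}"
  proof (intro equalityI subsetI)
    fix u assume u: "u \<in> {s<..<\<tau>}"
    obtain i :: nat where "inverse (Suc i) < (\<tau> - u) / (\<tau> - s)"
      using reals_Archimedean[of "(\<tau> - u) / (\<tau> - s)"] u by auto
    then have "u \<le> x i" using u by (simp add: x_def field_simps)
    then show "u \<in> (\<Union>i. {s<..x i})" using u by auto
  qed (use x(2) in \<open>auto intro: le_less_trans\<close>)
  ultimately have "AE u in jump_measure k. u \<notin> {s<..<\<tau>}" using AE_not_in by force
  then have AE: "AE u in jump_measure k. indicator {s<..\<tau>} u *\<^sub>R h k u = indicator {s<..\<tau>} u *\<^sub>R h k \<tau>"
    by (rule eventually_mono) (auto simp: indicator_def)
  have int: "integrable (jump_measure k) (\<lambda>u. indicator {s<..\<tau>} u *\<^sub>R h k u)"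
    using h_integrable[OF k, of "{s<..\<tau>}" "jump_measure k"] s emeasure_jump_measure[OF k, of s \<tau>]
    unfolding set_integrable_def by (auto simp: subset_eq)
  have "(LINT u:{s<..\<tau>}|jump_measure k. h k u) = (LINT u|jump_measure k. indicator {s<..\<tau>} u *\<^sub>R h k \<tau>)"
    unfolding set_lebesgue_integral_def
    using AE borel_measurable_integrable[OF int] by (intro integral_cong_AE) auto
  also have "\<dots> = measure (jump_measure k) {s<..\<tau>} * h k \<tau>"
    by simp
  also have "measure (jump_measure k) {s<..\<tau>} = 1"
    using emeasure_jump_measure[OF k, of s \<tau>] s jump[of s]
    by (auto simp: measure_def)
  finally show ?thesis by simp
qed

lemma drift_bound:
  assumes k: "k \<in> {1..n}" and st: "0 \<le> s" "s \<le> t" "t \<le> T"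
    and B: "\<And>u. u \<in> {0..T} \<Longrightarrow> \<bar>left_lim m u\<bar> \<le> B"
  shows "\<bar>LINT u:{s<..t}|lborel. h k u\<bar> \<le> (\<bar>K\<bar> + 1) * B * (t - s)"
proof -
  have int: "set_integrable lborel {s<..t} (h k)" using st by (intro h_integrable[OF k]) auto
  have "\<bar>LINT u:{s<..t}|lborel. h k u\<bar> \<le> (LINT u:{s<..t}|lborel. \<bar>h k u\<bar>)"
    using set_integral_norm_bound[OF int] by simp
  also have "\<dots> \<le> (LINT u:{s<..t}|lborel. (\<bar>K\<bar> + 1) * B)"
  proof (rule set_integral_mono)
    show "set_integrable lborel {s<..t} (\<lambda>u. \<bar>h k u\<bar>)" using int by (rule set_integrable_abs)
    show "set_integrable lborel {s<..t} (\<lambda>u. (\<bar>K\<bar> + 1) * B)"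
      unfolding set_integrable_def by (intro integrable_scaleR_left) (simp add: integrable_indicator_iff emeasure_lborel_Ioc st)
    show "\<bar>h k u\<bar> \<le> (\<bar>K\<bar> + 1) * B" if "u \<in> {s<..t}" for u
      using order_trans[OF h_bound[OF k] mult_left_mono[OF B]] that st by auto
  qed
  also have "\<dots> = (\<bar>K\<bar> + 1) * B * (t - s)"
    using st by (simp add: set_lebesgue_integral_def)
  finally show ?thesis .
qed

lemma D_ge: "1 \<le> D" "K \<le> D" "1 / c \<le> D"
  by (auto simp: D_def)

lemma C_nonneg: "0 \<le> C" by (simp add: C_def)

text \<open>Without jumps only the Lebesgue integrals of the drift remain. The crude bound makes
  \<open>m\<close> Lipschitz, hence continuous, hence equal to its left limits; only then is the
  drift bounded by \<open>C\<close> times the integral of |m|, as Gronwall's inequality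
  requires.\<close>

lemma bounds_between_jumps:
  assumes st: "0 \<le> \<tau>" "\<tau> \<le> t" "t \<le> T" and eq: "total \<tau> = total t"
  shows "\<bar>m t\<bar> \<le> \<bar>m \<tau>\<bar> * exp (C * (t - \<tau>))" "\<bar>m \<tau>\<bar> \<le> \<bar>m t\<bar> * exp (C * (t - \<tau>))"
proof -
  have incr: "m r - m s = - (\<Sum>k=1..n. (LINT u:{s<..r}|lborel. h k u))"
    if sr: "\<tau> \<le> s" "s \<le> r" "r \<le> t" for s r
  proof -
    have "total s = total r"
      using total_mono[of \<tau> s] total_mono[of s r] total_mono[of r t] that st eq by simp
    then have "y k s = y k r" if "k \<in> {1..n}" for k
      using y_eq_of_total_eq[OF _ sr(2) _ _ that] st sr by auto
    then have "m r - m s = (\<Sum>k=1..n. 0 - (LINT u:{s<..r}|lborel. h k u))"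
      unfolding increment[of s r] using st sr increment[of s r]
      by (auto intro!: sum.cong jump_integral_zero)
    then show ?thesis by (simp add: sum_negf)
  qed
  obtain B where B: "B \<ge> 0" "\<And>u. u \<in> {0..T} \<Longrightarrow> \<bar>left_lim m u\<bar> \<le> B" using left_lim_m_bounded by blast
  have lip: "\<bar>m r - m s\<bar> \<le> (\<Sum>k=1..n. (\<bar>K\<bar> + 1) * B) * (r - s)" if sr: "\<tau> \<le> s" "s \<le> r" "r \<le> t" for s r
    unfolding incr[OF sr] abs_minus_cancel sum_distrib_right
    using sr st B by (intro order_trans[OF sum_abs] sum_mono drift_bound) auto
  have "((\<Sum>k=1..n. (\<bar>K\<bar> + 1) * B))-lipschitz_on {\<tau>..t} m"
  proof (rule lipschitz_onI)
    fix r s assume "r \<in> {\<tau>..t}" "s \<in> {\<tau>..t}"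
    then show "dist (m r) (m s) \<le> (\<Sum>k=1..n. (\<bar>K\<bar> + 1) * B) * dist r s"
      using lip[of s r] lip[of r s] by (cases "s \<le> r") (auto simp: dist_real_def abs_minus_commute)
  qed (use B in auto)
  then have cont: "continuous_on {\<tau>..t} m" by (rule lipschitz_on_continuous_on)
  have ll: "left_lim m u = m u" if "u \<in> {\<tau><..t}" for u
  proof (rule left_lim_eqI)
    have "continuous (at u within {\<tau>..t}) m"
      using cont that by (auto simp: continuous_on_eq_continuous_within)
    then have "(m \<longlongrightarrow> m u) (at u within {\<tau>..u})"
      using that unfolding continuous_within by (auto elim!: tendsto_within_subset)
    then show "(m \<longlongrightarrow> m u) (at_left u)"
      using that by (simp add: at_within_Icc_at_left)
  qed (use that st in auto)
  have gron: "\<bar>m r - m s\<bar> \<le> C * integral {s..r} (\<lambda>u. \<bar>m u\<bar>)" if sr: "\<tau> \<le> s" "s \<le> r" "r \<le> t" for s r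
  proof -
    have contm: "continuous_on {s..r} (\<lambda>u. \<bar>m u\<bar>)"
      using cont sr by (intro continuous_intros) (auto intro: continuous_on_subset)
    then have int: "set_integrable lborel {s..r} (\<lambda>u. \<bar>m u\<bar>)"
      by (rule borel_integrable_atLeastAtMost')
    then have int': "set_integrable lborel {s<..r} (\<lambda>u. \<bar>m u\<bar>)"
      by (rule set_integrable_subset) auto
    have I: "(LINT u:{s<..r}|lborel. \<bar>m u\<bar>) = integral {s..r} (\<lambda>u. \<bar>m u\<bar>)"
      unfolding set_borel_integral_eq_integral(2)[OF int']
      by (rule integral_subset_negligible, force, rule negligible_subset[OF negligible_sing[of s]]) auto
    have "\<bar>LINT u:{s<..r}|lborel. h k u\<bar> \<le> (\<bar>K\<bar> + 1) * integral {s..r} (\<lambda>u. \<bar>m u\<bar>)"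
      if k: "k \<in> {1..n}" for k
    proof -
      have inth: "set_integrable lborel {s<..r} (h k)" using st sr by (intro h_integrable[OF k]) auto
      have "\<bar>LINT u:{s<..r}|lborel. h k u\<bar> \<le> (LINT u:{s<..r}|lborel. \<bar>h k u\<bar>)"
        using set_integral_norm_bound[OF inth] by simp
      also have "\<dots> \<le> (LINT u:{s<..r}|lborel. (\<bar>K\<bar> + 1) * \<bar>m u\<bar>)"
      proof (rule set_integral_mono)
        show "\<bar>h k u\<bar> \<le> (\<bar>K\<bar> + 1) * \<bar>m u\<bar>" if "u \<in> {s<..r}" for u
          using h_bound[OF k, of u] ll[of u] that sr st by auto
      qed (use inth int' in \<open>auto intro: set_integrable_abs\<close>)
      finally show ?thesis using I by simp
    qed
    then have "(\<Sum>k=1..n. \<bar>LINT u:{s<..r}|lborel. h k u\<bar>) \<le> (\<Sum>k=1..n. (\<bar>K\<bar> + 1) * integral {s..r} (\<lambda>u. \<bar>m u\<bar>))"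
      by (rule sum_mono)
    then show ?thesis
      unfolding incr[OF sr] abs_minus_cancel by (intro order_trans[OF sum_abs]) (simp add: C_def algebra_simps)
  qed
  show "\<bar>m t\<bar> \<le> \<bar>m \<tau>\<bar> * exp (C * (t - \<tau>))" "\<bar>m \<tau>\<bar> \<le> \<bar>m t\<bar> * exp (C * (t - \<tau>))"
    using gronwall_two_sided[OF st(2) C_nonneg cont gron] by auto
qed

text \<open>At a time where \<open>total\<close> reaches a new value, exactly one path jumps, and by
  one. The increment of \<open>m\<close> over (u,\<tau>] is then \<open>h k \<tau>\<close> up to a
  drift of order \<tau> - u; letting u tend to \<tau> turns the additive jump
  \<open>(g k \<tau> - 1) * left_lim m \<tau>\<close> into the factor
  \<open>g k \<tau>\<close>.\<close>

lemma jump: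
  assumes \<tau>: "0 < \<tau>" "\<tau> \<le> T" and before: "\<And>s. 0 \<le> s \<Longrightarrow> s < \<tau> \<Longrightarrow> total s < total \<tau>"
  obtains s k where "k \<in> {1..n}" "0 \<le> s" "s < \<tau>" "\<And>u. s \<le> u \<Longrightarrow> u < \<tau> \<Longrightarrow> total u + 1 = total \<tau>"
    "m \<tau> = g k \<tau> * left_lim m \<tau>" "(m \<longlongrightarrow> left_lim m \<tau>) (at_left \<tau>)"
proof -
  have "\<exists>s l. 0 \<le> s \<and> s < \<tau> \<and> (\<forall>u. s \<le> u \<and> u < \<tau> \<longrightarrow> y j u = l) \<and> l \<le> y j \<tau> \<and> y j \<tau> \<le> l + 1"
    if "j \<in> {1..n}" for j
    using counting_path_left[OF paths[OF that] \<tau>] by metis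
  then obtain s l where sl: "\<And>j. j \<in> {1..n} \<Longrightarrow> 0 \<le> s j \<and> s j < \<tau> \<and>
    (\<forall>u. s j \<le> u \<and> u < \<tau> \<longrightarrow> y j u = l j) \<and> l j \<le> y j \<tau> \<and> y j \<tau> \<le> l j + 1" by metis
  \<comment> \<open>From \<open>s0\<close> until just before \<tau> all paths sit on their last
    plateaus at once.\<close>
  define s0 where "s0 = Max (insert 0 (s ` {1..n}))"
  have s0: "0 \<le> s0" "s0 < \<tau>" "\<And>j. j \<in> {1..n} \<Longrightarrow> s j \<le> s0"
    unfolding s0_def using sl \<tau> by (auto intro!: Max_ge simp del: Max_insert)
  have y_l: "y j u = l j" if "j \<in> {1..n}" "s0 \<le> u" "u < \<tau>" for j u
    using sl[OF that(1)] s0(3)[OF that(1)] that by auto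
  have "\<exists>k\<in>{1..n}. y k s0 \<noteq> y k \<tau>"
    using before[OF s0(1,2)] by (auto simp: total_def intro: ccontr)
  then obtain k where k: "k \<in> {1..n}" "l k + 1 = y k \<tau>"
    using sl y_l[of _ s0] s0 by (metis Suc_eq_plus1 le_Suc_eq le_antisym order_refl)
  \<comment> \<open>The time \<open>max r s0\<close> lies on the plateaus and after
    \<open>r\<close>, so by monotonicity one of the two paths has its plateau at its value at
    \<tau>; for \<open>k\<close> this is false, so it is \<open>j\<close>.\<close>
  have other: "l j = y j \<tau>" if j: "j \<in> {1..n}" "j \<noteq> k" for j
  proof -
    obtain r where r: "r \<in> {0..<\<tau>}" "y j r = y j \<tau> \<or> y k r = y k \<tau>"
      using no_common_jump[OF j(1) k(1) j(2), of \<tau>] \<tau> by auto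
    have "y k r \<le> y k (max r s0)" "y j r \<le> y j (max r s0)"
      using r(1) s0 \<tau> by (auto intro!: y_mono k(1) j(1))
    moreover have "y k (max r s0) = l k" "y j (max r s0) = l j"
      using r(1) s0 by (auto intro!: y_l k(1) j(1))
    ultimately show ?thesis using r(2) k(2) sl[OF j(1)] by auto
  qed
  have tot: "total u + 1 = total \<tau>" if "s0 \<le> u" "u < \<tau>" for u
  proof -
    have "total \<tau> = y k \<tau> + (\<Sum>j\<in>{1..n} - {k}. y j \<tau>)" "total u = y k u + (\<Sum>j\<in>{1..n} - {k}. y j u)"
      unfolding total_def using k(1) by (auto intro: sum.remove)
    moreover have "(\<Sum>j\<in>{1..n} - {k}. y j \<tau>) = (\<Sum>j\<in>{1..n} - {k}. y j u)"
      using y_l[OF _ that] other by (intro sum.cong) auto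
    ultimately show ?thesis using y_l[OF k(1) that] k(2) by simp
  qed
  obtain L where L: "(m \<longlongrightarrow> L) (at_left \<tau>)" using cadlag \<tau> unfolding cadlag_on_def by (meson greaterThanAtMost_iff)
  then have LL: "left_lim m \<tau> = L" using \<tau> by (intro left_lim_eqI)
  obtain B where B: "B \<ge> 0" "\<And>u. u \<in> {0..T} \<Longrightarrow> \<bar>left_lim m u\<bar> \<le> B" using left_lim_m_bounded by blast
  have diff: "\<bar>m u - (m \<tau> - h k \<tau>)\<bar> \<le> (\<Sum>k=1..n. (\<bar>K\<bar> + 1) * B) * (\<tau> - u)" if u: "s0 \<le> u" "u < \<tau>" for u
  proof -
    have "(LINT v:{u<..\<tau>}|jump_measure j. h j v) = (if j = k then h k \<tau> else 0)" if j: "j \<in> {1..n}" for j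
    proof (cases "j = k")
      case True
      then show ?thesis using u s0 \<tau> k y_l[OF k(1)]
        by (auto intro!: jump_integral_unit)
    next
      case False
      then show ?thesis using u s0 \<tau> j other[OF j False] y_l[OF j]
        by (auto intro!: jump_integral_zero)
    qed
    then have "m \<tau> - m u = h k \<tau> - (\<Sum>j=1..n. LINT v:{u<..\<tau>}|lborel. h j v)"
      using increment[of u \<tau>] u s0 \<tau> k(1) by (simp add: sum_subtractf)
    then have "\<bar>m u - (m \<tau> - h k \<tau>)\<bar> = \<bar>\<Sum>j=1..n. LINT v:{u<..\<tau>}|lborel. h j v\<bar>" by simp
    also have "\<dots> \<le> (\<Sum>k=1..n. (\<bar>K\<bar> + 1) * B) * (\<tau> - u)"
      unfolding sum_distrib_right
      using u s0 \<tau> B by (intro order_trans[OF sum_abs] sum_mono drift_bound) auto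
    finally show ?thesis .
  qed
  have "(m \<longlongrightarrow> m \<tau> - h k \<tau>) (at_left \<tau>)"
  proof (rule Lim_null[THEN iffD2], rule Lim_null_comparison)
    show "eventually (\<lambda>u. norm (m u - (m \<tau> - h k \<tau>)) \<le> (\<Sum>k=1..n. (\<bar>K\<bar> + 1) * B) * (\<tau> - u)) (at_left \<tau>)"
      using diff s0(2) by (auto simp: eventually_at_left[OF s0(2)] intro!: exI[of _ s0])
    show "((\<lambda>u. (\<Sum>k=1..n. (\<bar>K\<bar> + 1) * B) * (\<tau> - u)) \<longlongrightarrow> 0) (at_left \<tau>)"
      by (auto intro!: tendsto_eq_intros)
  qed
  then have "L = m \<tau> - h k \<tau>" using L by (intro tendsto_unique) auto
  then have "m \<tau> = g k \<tau> * left_lim m \<tau>" using LL by (simp add: h_def left_diff_distrib)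
  then show ?thesis using that[OF k(1) s0(1,2) tot] L LL by auto
qed

text \<open>The induction is on the number of jumps up to t; \<tau> is the last jump time before t.\<close>

lemma two_sided_bound:
  assumes "t \<in> {0..T}"
  shows "\<bar>m t\<bar> \<le> R t \<and> 1 \<le> \<bar>m t\<bar> * R t"
  using assms
proof (induction "total t" arbitrary: t rule: less_induct)
  case less
  define A where "A = {s \<in> {0..T}. total s = total t}"
  define \<tau> where "\<tau> = Inf A"
  have A: "t \<in> A" "bdd_below A" using less.prems by (auto simp: A_def intro!: bdd_belowI[of _ 0])
  have \<tau>: "0 \<le> \<tau>" "\<tau> \<le> t" "\<tau> \<le> T"
    unfolding \<tau>_def using A less.prems cInf_lower[OF A] by (auto intro!: cInf_greatest simp: A_def)
  \<comment> \<open>The infimum is attained by right-continuity: all paths are constant on a common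
    interval of length \<open>e\<close> to the right of \<tau>, and this interval meets
    \<open>A\<close>.\<close>
  have tot\<tau>: "total \<tau> = total t"
  proof -
    have "\<exists>d>0. \<forall>u. \<tau> \<le> u \<and> u < \<tau> + d \<and> u \<le> T \<longrightarrow> y k u = y k \<tau>" if "k \<in> {1..n}" for k
      using counting_path_right[OF paths[OF that], of \<tau>] \<tau> by (metis atLeastAtMost_iff)
    then obtain d where d: "\<And>k. k \<in> {1..n} \<Longrightarrow> d k > 0 \<and> (\<forall>u. \<tau> \<le> u \<and> u < \<tau> + d k \<and> u \<le> T \<longrightarrow> y k u = y k \<tau>)"
      by metis
    define e where "e = Min (insert 1 (d ` {1..n}))"
    have "0 < e" unfolding e_def using d by (subst Min_gr_iff) auto
    moreover have "e \<le> d k" if "k \<in> {1..n}" for k unfolding e_def using that by (intro Min_le) auto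
    ultimately have e: "0 < e" "\<And>k. k \<in> {1..n} \<Longrightarrow> e \<le> d k" by auto
    obtain u where u: "u \<in> A" "u < \<tau> + e"
      using cInf_less_iff[of A "\<tau> + e"] A e(1) unfolding \<tau>_def by auto
    have "\<tau> \<le> u" unfolding \<tau>_def using u(1) A by (intro cInf_lower)
    have "y k u = y k \<tau>" if "k \<in> {1..n}" for k
    proof -
      have "u < \<tau> + d k" "u \<le> T" using e(2)[OF that] u by (auto simp: A_def)
      then show ?thesis using d[OF that] \<open>\<tau> \<le> u\<close> by blast
    qed
    then have "total u = total \<tau>" by (simp add: total_def)
    then show ?thesis using u(1) by (simp add: A_def)
  qed
  have main: "\<bar>m \<tau>\<bar> \<le> R \<tau> \<and> 1 \<le> \<bar>m \<tau>\<bar> * R \<tau>"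
  proof (cases "\<tau> = 0")
    case True
    have "(LINT u:{0..0}|lborel. f u) = 0" for f :: "real \<Rightarrow> real"
      unfolding set_lebesgue_integral_def
      by (rule integral_eq_zero_AE, rule eventually_mono[OF AE_lborel_singleton[of 0]]) auto
    then have "m 0 = 1"
      using equation[of 0] T by (simp add: stieltjes_integral_def set_lebesgue_integral_def)
    moreover have "total 0 = 0" using paths by (simp add: total_def counting_path_def)
    ultimately show ?thesis by (simp add: True R_def)
  next
    case False
    with \<tau> have "0 < \<tau>" by simp
    have "total s < total \<tau>" if "0 \<le> s" "s < \<tau>" for s
    proof -
      have "s \<notin> A" using that cInf_lower[OF _ A(2), of s] unfolding \<tau>_def by auto
      then have "total s \<noteq> total \<tau>" using that \<tau> by (auto simp: A_def tot\<tau>)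
      then show ?thesis using total_mono[of s \<tau>] that \<tau> by simp
    qed
    from jump[OF \<open>0 < \<tau>\<close> \<tau>(3) this] obtain s k where
      k: "k \<in> {1..n}" and s: "0 \<le> s" "s < \<tau>" "\<And>u. s \<le> u \<Longrightarrow> u < \<tau> \<Longrightarrow> total u + 1 = total \<tau>"
      and m\<tau>: "m \<tau> = g k \<tau> * left_lim m \<tau>" and lim: "(m \<longlongrightarrow> left_lim m \<tau>) (at_left \<tau>)" by metis
    \<comment> \<open>The bound just before the jump has one factor \<open>D\<close> less; the
      subtraction is exact because \<open>total \<tau>\<close> is at least 1.\<close>
    define R' where "R' = exp (C * \<tau>) * D ^ (total \<tau> - 1)"
    have "total \<tau> \<ge> 1" using s(3)[of s] s(2) by simp
    then have RR': "R \<tau> = R' * D" by (cases "total \<tau>") (auto simp: R_def R'_def)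
    have R'0: "0 \<le> R'" using D_ge(1) by (simp add: R'_def)
    \<comment> \<open>The induction hypothesis applies at every time shortly before \<tau>, where
      one jump fewer has occurred. Both inequalities are closed and pass to the left limit.\<close>
    have ev: "eventually (\<lambda>u. \<bar>m u\<bar> \<le> R' \<and> 1 \<le> \<bar>m u\<bar> * R') (at_left \<tau>)"
    proof -
      have "\<bar>m u\<bar> \<le> R' \<and> 1 \<le> \<bar>m u\<bar> * R'" if u: "s < u" "u < \<tau>" for u
      proof -
        have "total u < total t" using s(3)[of u] u tot\<tau> by simp
        then have IH: "\<bar>m u\<bar> \<le> R u \<and> 1 \<le> \<bar>m u\<bar> * R u"
          using less.hyps[of u] u s \<tau> by auto
        have "total u = total \<tau> - 1" using s(3)[of u] u by simp
        then have "R u \<le> R'"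
          unfolding R_def R'_def using u C_nonneg D_ge(1)
          by (intro mult_mono) (auto intro: mult_left_mono)
        then show ?thesis using IH mult_left_mono[of "R u" R' "\<bar>m u\<bar>"] by auto
      qed
      then show ?thesis using s(2) by (auto simp: eventually_at_left[OF s(2)])
    qed
    have lim_abs: "((\<lambda>u. \<bar>m u\<bar>) \<longlongrightarrow> \<bar>left_lim m \<tau>\<bar>) (at_left \<tau>)"
      using lim by (rule tendsto_rabs)
    have up: "\<bar>left_lim m \<tau>\<bar> \<le> R'"
      using tendsto_upperbound[OF lim_abs] ev by (auto simp: eventually_conj_iff)
    have low: "1 \<le> \<bar>left_lim m \<tau>\<bar> * R'"
      using tendsto_lowerbound[OF tendsto_mult_right[OF lim_abs, of R']] ev
      by (auto simp: eventually_conj_iff)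
    have g: "c \<le> g k \<tau>" "g k \<tau> \<le> K" using g_bounds[OF k, of \<tau>] \<tau> by auto
    have gD: "g k \<tau> \<le> D" "1 \<le> g k \<tau> * D"
    proof -
      show "g k \<tau> \<le> D" using g(2) D_ge(2) by simp
      have "1 = c * (1 / c)" using c by simp
      also have "\<dots> \<le> g k \<tau> * D" using g(1) D_ge(3) c by (intro mult_mono) auto
      finally show "1 \<le> g k \<tau> * D" .
    qed
    have abs: "\<bar>m \<tau>\<bar> = g k \<tau> * \<bar>left_lim m \<tau>\<bar>" using g(1) c unfolding m\<tau> by (simp add: abs_mult)
    have "\<bar>m \<tau>\<bar> \<le> D * R'"
      unfolding abs using gD(1) up D_ge(1) by (intro mult_mono) auto
    moreover have "1 * 1 \<le> (g k \<tau> * D) * (\<bar>left_lim m \<tau>\<bar> * R')"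
      using gD(2) low by (intro mult_mono) auto
    ultimately show ?thesis unfolding RR' abs by (simp add: algebra_simps)
  qed
  have E: "exp (C * (t - \<tau>)) * R \<tau> = R t"
    unfolding R_def tot\<tau> mult.assoc[symmetric] exp_add[symmetric] by (simp add: right_diff_distrib)
  note b = bounds_between_jumps[OF \<tau>(1,2) _ tot\<tau>]
  have "\<bar>m t\<bar> \<le> R \<tau> * exp (C * (t - \<tau>))"
    using b(1) main less.prems by (meson atLeastAtMost_iff exp_ge_zero mult_right_mono order_trans)
  moreover have "1 \<le> \<bar>m t\<bar> * exp (C * (t - \<tau>)) * R \<tau>"
  proof -
    have "0 \<le> R \<tau>" using D_ge(1) by (simp add: R_def)
    then have "\<bar>m \<tau>\<bar> * R \<tau> \<le> \<bar>m t\<bar> * exp (C * (t - \<tau>)) * R \<tau>"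
      using b(2) less.prems by (intro mult_right_mono) auto
    with main show ?thesis by simp
  qed
  ultimately show ?case using E by (simp add: mult.assoc mult.commute[of "R \<tau>"])
qed

text \<open>Nonnegative \<open>q\<close> uses the bound on |m|, negative \<open>q\<close> the bound
  on 1/|m|. Since \<open>R\<close> is nondecreasing, the majorant is free of \<open>t\<close>, and
  the supremum over time costs nothing.\<close>

lemma abs_powr_bound:
  assumes t: "t \<in> {0..T}"
  shows "\<bar>m t\<bar> powr q \<le> R T powr \<bar>q\<bar>"
proof -
  note b = two_sided_bound[OF t]
  have R: "0 < R t" "R t \<le> R T"
    using t D_ge(1) C_nonneg total_mono[of t T]
    by (auto simp: R_def intro!: mult_mono mult_left_mono power_increasing)
  have m0: "0 < \<bar>m t\<bar>" using b by (cases "m t = 0") auto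
  have "\<bar>m t\<bar> powr q \<le> R t powr \<bar>q\<bar>"
  proof (cases "0 \<le> q")
    case True
    then show ?thesis using b by (auto intro: powr_mono2)
  next
    case False
    have "\<bar>m t\<bar> powr q = (1 / \<bar>m t\<bar>) powr \<bar>q\<bar>"
      using False m0 by (simp add: powr_minus_divide powr_divide powr_minus)
    also have "\<dots> \<le> R t powr \<bar>q\<bar>"
      using b m0 R by (intro powr_mono2) (auto simp: field_simps)
    finally show ?thesis .
  qed
  also have "\<dots> \<le> R T powr \<bar>q\<bar>" using R by (intro powr_mono2) auto
  finally show ?thesis .
qed

lemma m_nonzero: "t \<in> {0..T} \<Longrightarrow> m t \<noteq> 0"
  using two_sided_bound[of t] by auto

end


section \<open>Generated sigma-algebras and Poisson processes\<close>

lemma sets_generated: "sets (generated \<Omega> I S f) = sigma_sets \<Omega> {f i -` A \<inter> \<Omega> | i A. i \<in> I \<and> A \<in> sets S}"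
  unfolding generated_def by (rule sets_measure_of) auto

lemma space_generated [simp]: "space (generated \<Omega> I S f) = \<Omega>"
  by (simp add: generated_def space_measure_of_conv)

lemma generated_measurable:
  assumes "i \<in> I" "f i \<in> \<Omega> \<rightarrow> space S"
  shows "f i \<in> measurable (generated \<Omega> I S f) S"
  using assms by (intro measurableI) (auto simp: sets_generated intro!: sigma_sets.Basic)

lemma sets_generated_subset:
  assumes "space M = \<Omega>" "\<And>i. i \<in> I \<Longrightarrow> f i \<in> measurable M S"
  shows "sets (generated \<Omega> I S f) \<subseteq> sets M"
  unfolding sets_generated assms(1)[symmetric]
  using assms(2) by (intro sets.sigma_sets_subset) (auto intro: measurable_sets)

lemma sum_nat_le_card_times:
  fixes y :: "nat \<Rightarrow> nat"
  assumes "n \<ge> 1"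
  obtains k where "k \<in> {1..n}" "(\<Sum>k=1..n. y k) \<le> n * y k"
proof -
  obtain k where k: "k \<in> {1..n}" "\<And>j. j \<in> {1..n} \<Longrightarrow> y j \<le> y k"
    using finite_has_maximal[of "y ` {1..n}"] assms by (metis (no_types, lifting) Max_ge Max_in atLeastAtMost_iff
      empty_iff finite_atLeastAtMost finite_imageI imageE image_eqI order_refl)
  have "(\<Sum>k=1..n. y k) \<le> (\<Sum>j=1..n. y k)" by (rule sum_mono) (use k in auto)
  with k(1) show ?thesis using that by auto
qed

text \<open>The sum of the counts is at most \<open>n\<close> times the largest one, whose power is
  among the summands. An exponential moment of the total thus reduces to exponential moments of
  single Poisson variables.\<close>

lemma power_sum_le_sum_power:
  fixes z :: real and y :: "nat \<Rightarrow> nat"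
  assumes "n \<ge> 1" "1 \<le> z"
  shows "z ^ (\<Sum>k=1..n. y k) \<le> (\<Sum>k=1..n. (z ^ n) ^ y k)"
proof -
  obtain k where k: "k \<in> {1..n}" "(\<Sum>k=1..n. y k) \<le> n * y k"
    using sum_nat_le_card_times[OF assms(1)] by blast
  have "z ^ (\<Sum>k=1..n. y k) \<le> (z ^ n) ^ y k"
    using power_increasing[OF k(2) assms(2)] by (simp add: power_mult)
  also have "\<dots> \<le> (\<Sum>k=1..n. (z ^ n) ^ y k)"
    using assms(2) k(1) by (intro member_le_sum[of k _ "\<lambda>k. (z ^ n) ^ y k"]) auto
  finally show ?thesis .
qed

context prob_space
begin

text \<open>The law is given for increments, and Z 0 = 0 almost surely, so Z T is Poisson; the
  moment becomes an exponential series in T z, which converges for every z.\<close>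

lemma unit_poisson_process_exponential_moment:
  assumes Z: "unit_poisson_process M {0..T} Z" and T: "0 < T" and z: "(0::real) \<le> z"
  shows "(\<integral>\<^sup>+\<omega>. ennreal (z ^ Z T \<omega>) \<partial>M) < \<infinity>"
proof -
  have [measurable]: "Z T \<in> measurable M (count_space UNIV)" "Z 0 \<in> measurable M (count_space UNIV)"
    using Z T by (auto simp: unit_poisson_process_def)
  have "AE \<omega> in M. Z 0 \<omega> = 0"
    using Z by (auto simp: unit_poisson_process_def counting_path_def elim: eventually_mono)
  then have "(\<integral>\<^sup>+\<omega>. ennreal (z ^ Z T \<omega>) \<partial>M) = (\<integral>\<^sup>+\<omega>. ennreal (z ^ (Z T \<omega> - Z 0 \<omega>)) \<partial>M)"
    by (intro nn_integral_cong_AE) (auto elim: eventually_mono)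
  also have "\<dots> = (\<integral>\<^sup>+x. ennreal (z ^ x) \<partial>distr M (count_space UNIV) (\<lambda>\<omega>. Z T \<omega> - Z 0 \<omega>))"
    by (subst nn_integral_distr) auto
  also have "distr M (count_space UNIV) (\<lambda>\<omega>. Z T \<omega> - Z 0 \<omega>) = measure_pmf (poisson_pmf T)"
    using Z T by (auto simp: unit_poisson_process_def)
  also have "(\<integral>\<^sup>+x. ennreal (z ^ x) \<partial>measure_pmf (poisson_pmf T)) =
      (\<Sum>x. ennreal (exp (- T) * ((T * z) ^ x / fact x)))"
    using T z unfolding nn_integral_measure_pmf nn_integral_count_space_nat
    by (intro suminf_cong) (simp add: ennreal_mult[symmetric] power_mult_distrib algebra_simps)
  also have "\<dots> < \<infinity>"
  proof -
    have "summable (\<lambda>x. exp (- T) * ((T * z) ^ x / fact x))"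
      using summable_exp[of "T * z"] by (intro summable_mult) (simp add: field_simps)
    then show ?thesis
      using T z unfolding infinity_ennreal_def less_top[symmetric] by (intro ennreal_suminf_neq_top) auto
  qed
  finally show ?thesis .
qed

lemma unit_poisson_process_increment_prob:
  assumes Z: "unit_poisson_process M {0..T} Z" and st: "0 \<le> s" "s < t" "t \<le> T"
  shows "prob {\<omega> \<in> space M. Z t \<omega> - Z s \<omega> \<noteq> 0} \<le> t - s"
proof -
  have [measurable]: "Z t \<in> measurable M (count_space UNIV)" "Z s \<in> measurable M (count_space UNIV)"
    using Z st by (auto simp: unit_poisson_process_def)
  have "prob {\<omega> \<in> space M. Z t \<omega> - Z s \<omega> \<noteq> 0} =
    measure (distr M (count_space UNIV) (\<lambda>\<omega>. Z t \<omega> - Z s \<omega>)) (- {0})"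
    by (subst measure_distr) (auto intro!: arg_cong[where f=prob])
  also have "distr M (count_space UNIV) (\<lambda>\<omega>. Z t \<omega> - Z s \<omega>) = measure_pmf (poisson_pmf (t - s))"
    using Z st by (auto simp: unit_poisson_process_def)
  also have "measure (measure_pmf (poisson_pmf (t - s))) (- {0}) = 1 - exp (- (t - s))"
    using st measure_pmf.prob_compl[of "{0}" "poisson_pmf (t - s)"]
    by (simp add: measure_pmf_single Compl_eq_Diff_UNIV)
  also have "\<dots> \<le> t - s" using exp_ge_add_one_self[of "- (t - s)"] by linarith
  finally show ?thesis .
qed

text \<open>If both processes jump at the same time, then on every uniform grid with N cells both have an
  increment in a common cell, an event of probability at most N (T/N)^2.\<close>

lemma poisson_no_common_jump:
  assumes sys: "poisson_system_indep_of M T n {0..T} Y X" and T: "0 < T"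
    and jk: "j \<in> {1..n}" "k \<in> {1..n}" "j \<noteq> k"
  shows "AE \<omega> in M. \<forall>t\<in>{0<..T}. \<exists>s\<in>{0..<t}. Y j s \<omega> = Y j t \<omega> \<or> Y k s \<omega> = Y k t \<omega>"
proof -
  have pois: "unit_poisson_process M {0..T} (Y l)" if "l \<in> {1..n}" for l
    using sys that by (auto simp: poisson_system_indep_of_def)
  have indep: "indep_sets (\<lambda>k. sets (generated (space M) {0..T} (count_space UNIV) (Y k))) {1..n}"
    using sys by (auto simp: poisson_system_indep_of_def)
  define t where "t N i = T * real i / real (Suc N)" for N i :: nat
  define B where "B N i l = {\<omega> \<in> space M. Y l (t N (Suc i)) \<omega> - Y l (t N i) \<omega> \<noteq> 0}" for N i l
  define A where "A N = (\<Union>i<Suc N. B N i j \<inter> B N i k)" for N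
  have t: "t N i \<in> {0..T}" if "i \<le> Suc N" for N i
    using that T by (auto simp: t_def divide_le_eq intro!: mult_left_mono)
  have t_diff: "t N (Suc i) - t N i = T / real (Suc N)" for N i
    by (simp add: t_def diff_divide_distrib[symmetric] algebra_simps del: of_nat_Suc) (simp add: algebra_simps)
  \<comment> \<open>Independence of the processes is a statement about their generated
    sigma-algebras, so the events must be placed there before probabilities can be
    multiplied.\<close>
  have B_gen: "B N i l \<in> sets (generated (space M) {0..T} (count_space UNIV) (Y l))"
    if "i < Suc N" for N i l
  proof -
    have [measurable]: "Y l (t N i) \<in> measurable (generated (space M) {0..T} (count_space UNIV) (Y l)) (count_space UNIV)"
      "Y l (t N (Suc i)) \<in> measurable (generated (space M) {0..T} (count_space UNIV) (Y l)) (count_space UNIV)"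
      using t[of i N] t[of "Suc i" N] that by (auto intro!: generated_measurable)
    have "{\<omega> \<in> space (generated (space M) {0..T} (count_space UNIV) (Y l)). Y l (t N (Suc i)) \<omega> - Y l (t N i) \<omega> \<noteq> 0}
      \<in> sets (generated (space M) {0..T} (count_space UNIV) (Y l))"
      by measurable
    then show ?thesis by (simp add: B_def)
  qed
  have B_ev: "B N i l \<in> events" if "i < Suc N" "l \<in> {1..n}" for N i l
    using indep B_gen[OF that(1), of l] that(2) unfolding indep_sets_def by blast
  have prob_B: "prob (B N i l) \<le> T / real (Suc N)" if "i < Suc N" "l \<in> {1..n}" for N i l
    using unit_poisson_process_increment_prob[OF pois[OF that(2)], of "t N i" "t N (Suc i)"]
      t[of i N] t[of "Suc i" N] t_diff[of N i] that(1) T unfolding B_def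
    by (metis atLeastAtMost_iff diff_gt_0_iff_gt divide_pos_pos le_SucI less_eq_Suc_le less_imp_le of_nat_0_less_iff zero_less_Suc)
  have prob_BB: "prob (B N i j \<inter> B N i k) \<le> (T / real (Suc N))\<^sup>2" if "i < Suc N" for N i
  proof -
    have "prob (\<Inter>l\<in>{j, k}. B N i l) = (\<Prod>l\<in>{j, k}. prob (B N i l))"
      by (rule indep_setsD[OF indep]) (use jk B_gen[OF that] in auto)
    then have "prob (B N i j \<inter> B N i k) = prob (B N i j) * prob (B N i k)" using jk(3) by simp
    also have "\<dots> \<le> (T / real (Suc N)) * (T / real (Suc N))"
      using prob_B[OF that] jk T by (intro mult_mono) auto
    finally show ?thesis by (simp add: power2_eq_square)
  qed
  have A_ev: "A N \<in> events" for N
    unfolding A_def using B_ev jk by (intro sets.finite_UN sets.Int) auto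
  have prob_A: "prob (A N) \<le> T\<^sup>2 * inverse (real (Suc N))" for N
  proof -
    have "prob (A N) \<le> (\<Sum>i<Suc N. prob (B N i j \<inter> B N i k))"
      unfolding A_def using B_ev jk by (intro finite_measure_subadditive_finite) auto
    also have "\<dots> \<le> (\<Sum>i<Suc N. (T / real (Suc N))\<^sup>2)"
      by (intro sum_mono prob_BB) auto
    also have "\<dots> = T\<^sup>2 * inverse (real (Suc N))"
      by (simp add: power2_eq_square field_simps del: of_nat_Suc)
    finally show ?thesis .
  qed
  have "prob (\<Inter>N. A N) = 0"
  proof -
    have "prob (\<Inter>N. A N) \<le> T\<^sup>2 * inverse (real (Suc N))" for N
      using A_ev by (intro order_trans[OF finite_measure_mono prob_A]) auto
    moreover have "(\<lambda>N. T\<^sup>2 * inverse (real (Suc N))) \<longlonglongrightarrow> 0"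
      using tendsto_mult_left[OF LIMSEQ_inverse_real_of_nat, of "T\<^sup>2"] by simp
    ultimately have "prob (\<Inter>N. A N) \<le> 0" by (intro LIMSEQ_le_const) auto
    then show ?thesis by (simp add: measure_le_0_iff)
  qed
  then have "(\<Inter>N. A N) \<in> null_sets M"
    using A_ev by (intro null_setsI) (auto simp: emeasure_eq_measure)
  then have "AE \<omega> in M. \<omega> \<notin> (\<Inter>N. A N)" by (rule AE_not_in)
  moreover have "AE \<omega> in M. counting_path {0..T} (\<lambda>t. Y j t \<omega>)" "AE \<omega> in M. counting_path {0..T} (\<lambda>t. Y k t \<omega>)"
    using pois[OF jk(1)] pois[OF jk(2)] by (auto simp: unit_poisson_process_def)
  ultimately show ?thesis
    using AE_space
  proof eventually_elim
    case (elim \<omega>)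
    show ?case
    proof (rule ccontr)
      assume "\<not> ?thesis"
      then obtain r where r: "0 < r" "r \<le> T"
        "\<And>s. 0 \<le> s \<Longrightarrow> s < r \<Longrightarrow> Y j s \<omega> \<noteq> Y j r \<omega> \<and> Y k s \<omega> \<noteq> Y k r \<omega>" by auto
      have "\<omega> \<in> A N" for N
      proof -
        \<comment> \<open>The cell is chosen with \<open>t N i < r \<le> t N (Suc i)\<close>. The
          strict left inequality is essential: the path must not yet have its value at
          \<open>r\<close> at the left grid point.\<close>
        define i where "i = nat (\<lceil>r * real (Suc N) / T\<rceil> - 1)"
        have pos: "0 < r * real (Suc N) / T" using r T by simp
        then have ri: "real i < r * real (Suc N) / T" "r * real (Suc N) / T \<le> real (Suc i)"
          unfolding i_def by linarith+
        have "r * real (Suc N) / T \<le> real (Suc N)"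
          using r T by (simp add: divide_le_eq mult_right_mono)
        then have iN: "i < Suc N" using ri(1) by linarith
        have lo: "t N i < r" and hi: "r \<le> t N (Suc i)"
          using ri T by (simp_all add: t_def field_simps del: of_nat_Suc)
        have "Y l (t N (Suc i)) \<omega> - Y l (t N i) \<omega> \<noteq> 0" if l: "l \<in> {j, k}" for l
        proof -
          have m: "mono_on {0..T} (\<lambda>t. Y l t \<omega>)" using elim l by (auto simp: counting_path_def)
          have "Y l (t N i) \<omega> \<le> Y l r \<omega>" "Y l r \<omega> \<le> Y l (t N (Suc i)) \<omega>"
            using mono_onD[OF m, of "t N i" r] mono_onD[OF m, of r "t N (Suc i)"]
              t[of i N] t[of "Suc i" N] lo hi r iN by auto
          moreover have "Y l (t N i) \<omega> \<noteq> Y l r \<omega>"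
            using r(3)[of "t N i"] t[of i N] lo iN l by auto
          ultimately show ?thesis by auto
        qed
        then show ?thesis using iN elim by (auto simp: A_def B_def)
      qed
      then show False using elim by auto
    qed
  qed
qed

end

lemma subalgebra_full_algebra:
  assumes space: "complete_filtered_prob_space T P F" and W: "brownian_motion T P F W"
    and Nb: "poisson_random_measure T P F \<nu> Nb"
    and Y: "\<forall>k\<in>{1..n}. \<forall>t\<in>{0..T}. Y k t \<in> measurable P (count_space UNIV)"
    and t: "t \<in> {0..T}"
  shows "subalgebra P (full_algebra P \<nu> W Nb n Y t)"
    and "sets (obs_algebra (space P) n Y t) \<subseteq> sets (full_algebra P \<nu> W Nb n Y t)"
    and "null_sets P \<subseteq> sets (full_algebra P \<nu> W Nb n Y t)"
proof -
  let ?gens = "sets (generated (space P) {0..t} borel W) \<union>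
      sets (generated (space P) {A \<in> sets (prm_intensity \<nu>). A \<subseteq> {0..t} \<times> UNIV} borel
              (\<lambda>A \<omega>. emeasure (Nb \<omega>) A)) \<union>
      sets (obs_algebra (space P) n Y t) \<union> null_sets P"
  have "W s \<in> borel_measurable P" if "s \<in> {0..t}" for s
  proof -
    have "s \<in> {0..T}" using that t by auto
    then have "W s \<in> borel_measurable (F s)" "subalgebra P (F s)"
      using space W unfolding brownian_motion_def complete_filtered_prob_space_def by blast+
    then show ?thesis by (rule measurable_from_subalg[rotated])
  qed
  then have "sets (generated (space P) {0..t} borel W) \<subseteq> sets P"
    by (intro sets_generated_subset) auto
  moreover have "sets (generated (space P) {A \<in> sets (prm_intensity \<nu>). A \<subseteq> {0..t} \<times> UNIV} borel
              (\<lambda>A \<omega>. emeasure (Nb \<omega>) A)) \<subseteq> sets P"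
    using Nb by (intro sets_generated_subset) (auto simp: poisson_random_measure_def)
  moreover have "sets (obs_algebra (space P) n Y t) \<subseteq> sets P"
    unfolding obs_algebra_def using Y t by (intro sets_generated_subset) auto
  ultimately have sub: "?gens \<subseteq> sets P" by auto
  then have gens: "?gens \<subseteq> Pow (space P)" using sets.space_closed[of P] by blast
  have sets: "sets (full_algebra P \<nu> W Nb n Y t) = sigma_sets (space P) ?gens"
    unfolding full_algebra_def by (rule sets_measure_of[OF gens])
  show "subalgebra P (full_algebra P \<nu> W Nb n Y t)"
    unfolding subalgebra_def sets using sets.sigma_sets_subset[OF sub]
    by (simp add: full_algebra_def space_measure_of_conv)
  show "sets (obs_algebra (space P) n Y t) \<subseteq> sets (full_algebra P \<nu> W Nb n Y t)"
    "null_sets P \<subseteq> sets (full_algebra P \<nu> W Nb n Y t)"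
    unfolding sets by (auto intro: sigma_sets.Basic)
qed

text \<open>Equivalence compares the measures only on \<open>G\<close>, but the exceptional set lies
  in a P-null set, and \<open>G\<close> contains all of these.\<close>

lemma AE_transfer_equivalent_on:
  assumes eq: "equivalent_on G P Q" and G: "subalgebra P G" "subalgebra Q G" "null_sets P \<subseteq> sets G"
    and AE: "AE \<omega> in P. \<Phi> \<omega>"
  shows "AE \<omega> in Q. \<Phi> \<omega>"
proof -
  obtain N where N: "{\<omega> \<in> space P. \<not> \<Phi> \<omega>} \<subseteq> N" "N \<in> null_sets P"
    using AE unfolding eventually_ae_filter by blast
  then have "N \<in> null_sets (restr_to_subalg P G)"
    using G null_sets_restr_to_subalg[OF G(1)] by auto
  then have "N \<in> null_sets Q"
    using eq null_sets_restr_to_subalg[OF G(2)] unfolding equivalent_on_def absolutely_continuous_def by auto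
  moreover have "space Q = space P" using G by (auto simp: subalgebra_def)
  ultimately show ?thesis using N(1) by (intro AE_I'[of N]) auto
qed

lemma obs_algebra_mono: "s \<le> t \<Longrightarrow> sets (obs_algebra \<Omega> n Y s) \<subseteq> sets (obs_algebra \<Omega> n Y t)"
  unfolding obs_algebra_def sets_generated by (intro sigma_sets_mono') fastforce

text \<open>The generators of the predictable sigma-algebra are measurable rectangles. Joint
  measurability makes the time integral of a control a \<open>G\<close>-measurable random
  variable.\<close>

lemma predictable_jointly_measurable:
  assumes u: "predictable T \<Omega> H u" and G: "space G = \<Omega>" "\<And>t. t \<in> {0..T} \<Longrightarrow> sets (H t) \<subseteq> sets G" and T: "0 \<le> T"
  shows "(\<lambda>(t, \<omega>). u t \<omega>) \<in> borel_measurable (restrict_space lborel {0..T} \<Otimes>\<^sub>M G)"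
proof -
  let ?N = "restrict_space lborel {0..T} \<Otimes>\<^sub>M G"
  have I: "A \<in> sets (restrict_space lborel {0..T})" if "A \<subseteq> {0..T}" "A \<in> sets borel" for A
    using that by (auto simp: sets_restrict_space_iff)
  have H: "A \<in> sets G" if "A \<in> sets (H t)" "t \<in> {0..T}" for A t using G that by auto
  have "(\<lambda>x. x) \<in> measurable ?N (predictable_algebra T \<Omega> H)"
    unfolding predictable_algebra_def
  proof (rule measurable_measure_of)
    show "{{0} \<times> A |A. A \<in> sets (H 0)} \<union> {{s<..r} \<times> A |s r A. 0 \<le> s \<and> s < r \<and> r \<le> T \<and> A \<in> sets (H s)}
      \<subseteq> Pow ({0..T} \<times> \<Omega>)"
      (is "?S1 \<union> ?S2 \<subseteq> _")
    proof (rule Un_least)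
      have A: "A \<subseteq> \<Omega>" if "A \<in> sets (H t)" "t \<in> {0..T}" for A t
        using sets.sets_into_space[OF H[OF that]] G(1) by simp
      show "?S1 \<subseteq> Pow ({0..T} \<times> \<Omega>)" using T A[of _ 0] by auto
      show "?S2 \<subseteq> Pow ({0..T} \<times> \<Omega>)"
      proof
        fix E assume "E \<in> ?S2"
        then obtain s r A' where "E = {s<..r} \<times> A'" "0 \<le> s" "s < r" "r \<le> T" "A' \<in> sets (H s)" by blast
        then show "E \<in> Pow ({0..T} \<times> \<Omega>)" using A[of A' s] by auto
      qed
    qed
    show "(\<lambda>x. x) \<in> space ?N \<rightarrow> {0..T} \<times> \<Omega>" using G(1) by (auto simp: space_pair_measure space_restrict_space)
    fix E assume E: "E \<in> {{0} \<times> A |A. A \<in> sets (H 0)} \<union> {{s<..r} \<times> A |s r A. 0 \<le> s \<and> s < r \<and> r \<le> T \<and> A \<in> sets (H s)}"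
    then have "E \<in> sets ?N"
    proof (elim UnE CollectE exE conjE)
      fix A assume "E = {0} \<times> A" "A \<in> sets (H 0)"
      then show ?thesis using T H[of A 0] by (auto intro!: pair_measureI I)
    next
      fix s r A assume "E = {s<..r} \<times> A" "0 \<le> s" "s < r" "r \<le> T" "A \<in> sets (H s)"
      then show ?thesis using H[of A s] by (auto intro!: pair_measureI I)
    qed
    then show "(\<lambda>x. x) -` E \<inter> space ?N \<in> sets ?N"
      using sets.sets_into_space[of E ?N] by (simp add: Int_absorb2)
  qed
  from measurable_comp[OF this u[unfolded predictable_def]] show ?thesis by (simp add: comp_def)
qed

text \<open>With \<open>w\<close> the power 4 (p0 - 1) of |x|: if w z is at least 1, the first term
  already dominates |x|^4; otherwise w < 1/z, and raising this to the power 1/(p0 - 1) turns w into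
  |x|^4.\<close>

lemma young_power4:
  fixes x z p0 :: real
  assumes "0 < z" "1 < p0"
  shows "\<bar>x\<bar> ^ 4 \<le> \<bar>x\<bar> powr (4 * p0) * z + z powr (- (1 / (p0 - 1)))"
proof (cases "x = 0")
  case False
  define w where "w = \<bar>x\<bar> powr (4 * (p0 - 1))"
  have w: "\<bar>x\<bar> ^ 4 = \<bar>x\<bar> powr 4" "\<bar>x\<bar> powr (4 * p0) = \<bar>x\<bar> ^ 4 * w"
    using False by (simp_all add: w_def powr_add[symmetric] algebra_simps flip: powr_numeral)
  show ?thesis
  proof (cases "1 \<le> w * z")
    case True
    then have "\<bar>x\<bar> ^ 4 * 1 \<le> \<bar>x\<bar> ^ 4 * (w * z)" by (intro mult_left_mono) auto
    also have "\<dots> = \<bar>x\<bar> powr (4 * p0) * z" using w by simp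
    finally show ?thesis by (simp add: add_increasing2)
  next
    case less: False
    then have "w \<le> z powr -1"
      using assms by (simp add: powr_minus_divide field_simps)
    then have "w powr (1 / (p0 - 1)) \<le> (z powr -1) powr (1 / (p0 - 1))"
      using assms by (intro powr_mono2) (auto simp: w_def)
    moreover have "w powr (1 / (p0 - 1)) = \<bar>x\<bar> ^ 4"
    proof -
      have "4 * (p0 - 1) * (1 / (p0 - 1)) = 4" using assms by (simp add: field_simps)
      then show ?thesis unfolding w(1) w_def powr_powr by simp
    qed
    ultimately have "\<bar>x\<bar> ^ 4 \<le> z powr (- (1 / (p0 - 1)))"
      unfolding powr_powr by simp
    then show ?thesis using assms(1) by (simp add: add_increasing)
  qed
qed (use assms in simp)


section \<open>Moments of the likelihood ratio\<close>

theorem lemma5: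
  fixes T x0 K1 K2 :: real
    and P Q :: "'a measure" and F :: "real \<Rightarrow> 'a measure"
    and W :: "real \<Rightarrow> 'a \<Rightarrow> real"
    and \<nu> :: "'e::polish_space measure" and mag :: "'e \<Rightarrow> real"
    and Nb :: "'a \<Rightarrow> (real \<times> 'e) measure"
    and U :: "real set"
    and b \<sigma> :: "real \<Rightarrow> real \<Rightarrow> real \<Rightarrow> real" and \<eta> :: "real \<Rightarrow> real \<Rightarrow> real \<Rightarrow> 'e \<Rightarrow> real"
    and v X M :: "real \<Rightarrow> 'a \<Rightarrow> real"
    and n :: nat and N Y :: "nat \<Rightarrow> real \<Rightarrow> 'a \<Rightarrow> nat"
    and a a' :: "real \<Rightarrow> real \<Rightarrow> real" and p p' :: "nat \<Rightarrow> real \<Rightarrow> real"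
  assumes T: "0 < T"
    and space: "complete_filtered_prob_space T P F"
    and W: "brownian_motion T P F W"
    and nu: "sets \<nu> = sets borel" "sigma_finite_measure \<nu>"
    and mag: "mag \<in> borel_measurable \<nu>" "\<And>\<zeta>. 0 \<le> mag \<zeta>"
      "(\<integral>\<^sup>+\<zeta>. ennreal (min 1 ((mag \<zeta>)\<^sup>2)) \<partial>\<nu>) < \<infinity>"
    and Nb: "poisson_random_measure T P F \<nu> Nb"
    and W_Nb_indep: "prob_space.indep_set P
      (sets (generated (space P) {0..T} borel W))
      (sets (generated (space P) (sets (prm_intensity \<nu>)) borel (\<lambda>A \<omega>. emeasure (Nb \<omega>) A)))"
    and U: "U \<noteq> {}" "convex U"
    and v: "predictable T (space P) F v" "\<forall>t\<in>{0..T}. \<forall>\<omega>\<in>space P. v t \<omega> \<in> U"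
    and X: "state_equation T P F \<nu> W Nb b \<sigma> \<eta> x0 v X"
    \<comment> \<open>observations\<close>
    and N: "poisson_system_indep_of P T n {0..} N X"
    and Y_meas: "\<forall>k\<in>{1..n}. \<forall>t\<in>{0..T}. Y k t \<in> measurable P (count_space UNIV)"
    and Y: "AE \<omega> in P. \<forall>k\<in>{1..n}. \<forall>t\<in>{0..T}.
      Y k t \<omega> = N k (LINT s:{0..t}|lborel. intensity_left a p k (\<lambda>r. X r \<omega>) s) \<omega>"
    and p_prob: "\<forall>k\<in>{1..n}. \<forall>x. 0 \<le> p k x" "\<forall>x. (\<Sum>k=1..n. p k x) = 1"
    \<comment> \<open>reference measure\<close>
    and Q: "prob_space Q" "sets Q = sets P"
      "equivalent_on (full_algebra P \<nu> W Nb n Y T) P Q"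
    and Q_law_X: "distr Q (\<Pi>\<^sub>M t\<in>{0..T}. borel) (\<lambda>\<omega>. \<lambda>t\<in>{0..T}. X t \<omega>) =
      distr P (\<Pi>\<^sub>M t\<in>{0..T}. borel) (\<lambda>\<omega>. \<lambda>t\<in>{0..T}. X t \<omega>)"
    and Q_Y: "poisson_system_indep_of Q T n {0..T} Y X"
    and M_ratio: "\<forall>t\<in>{0..T}. likelihood_ratio_on (full_algebra P \<nu> W Nb n Y t) P Q (M t)"
    and M_eq: "likelihood_equation T Q a p n X Y M"
    \<comment> \<open>(i)\<close>
    and K: "0 < K1" "K1 < K2"
    and a_meas: "(\<lambda>(x, t). a x t) \<in> borel_measurable (borel \<Otimes>\<^sub>M restrict_space borel {0..T})"
    and a_bounds: "\<forall>x. \<forall>t\<in>{0..T}. K1 \<le> a x t \<and> a x t \<le> K2"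
    and a_deriv: "\<forall>x. \<forall>t\<in>{0..T}. ((\<lambda>y. a y t) has_real_derivative a' x t) (at x)"
      "\<forall>t\<in>{0..T}. continuous_on UNIV (\<lambda>x. a' x t)"
      "\<exists>B. \<forall>x. \<forall>t\<in>{0..T}. \<bar>a' x t\<bar> \<le> B"
    \<comment> \<open>(ii)\<close>
    and p_deriv: "\<forall>k\<in>{1..n}. \<forall>x. (p k has_real_derivative p' k x) (at x)"
      "\<forall>k\<in>{1..n}. continuous_on UNIV (p' k)"
      "\<forall>k\<in>{1..n}. \<exists>B. \<forall>x. \<bar>p' k x\<bar> \<le> B"
    and p_inf: "0 < (INF (k, x)\<in>{1..n} \<times> UNIV. p k x)"
  shows "(\<forall>q::real. (SUP t\<in>{0..T}. \<integral>\<^sup>+\<omega>. ennreal (\<bar>M t \<omega>\<bar> powr q) \<partial>Q) < \<infinity>) \<and>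
    (\<forall>u\<in>admissible_controls T P U n Y.
      (\<integral>\<^sup>+\<omega>. (\<integral>\<^sup>+t\<in>{0..T}. ennreal (\<bar>u t \<omega>\<bar> ^ 4) \<partial>lborel) \<partial>Q) < \<infinity>)"
proof -
  interpret P: prob_space P using space by (simp add: complete_filtered_prob_space_def)
  interpret Q: prob_space Q by (rule Q(1))
  have spQ: "space Q = space P" using Q(2) by (rule sets_eq_imp_space_eq)
  define G where "G = full_algebra P \<nu> W Nb n Y T"
  have GP: "subalgebra P G" and obs_G: "sets (obs_algebra (space P) n Y T) \<subseteq> sets G"
    and null_G: "null_sets P \<subseteq> sets G"
    using subalgebra_full_algebra[OF space W Nb Y_meas, of T] T by (auto simp: G_def)
  have GQ: "subalgebra Q G" using GP spQ Q(2) by (simp add: subalgebra_def)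
  have "n \<noteq> 0" using p_prob(2) by (intro notI) simp
  then have n: "1 \<le> n" by simp

  \<comment> \<open>Bounds and measurability of the intensities\<close>
  define c where "c = K1 * (INF (k, x)\<in>{1..n} \<times> UNIV. p k x)"
  have c: "0 < c" using K(1) p_inf by (simp add: c_def)
  have p_low: "(INF (k, x)\<in>{1..n} \<times> UNIV. p k x) \<le> p k x" if "k \<in> {1..n}" for k x
  proof -
    have "bdd_below ((\<lambda>(k, x). p k x) ` ({1..n} \<times> UNIV))"
      using p_prob(1) by (intro bdd_belowI[of _ 0]) auto
    from cINF_lower[OF this, of "(k, x)"] that show ?thesis by simp
  qed
  have p_up: "p k x \<le> 1" if "k \<in> {1..n}" for k x
    using member_le_sum[of k "{1..n}" "\<lambda>k. p k x"] p_prob that by auto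
  have intens: "intensity a p k x t \<in> {c..K2}" if "k \<in> {1..n}" "t \<in> {0..T}" for k x t
  proof -
    have a: "K1 \<le> a x t" "a x t \<le> K2" using a_bounds that by auto
    have "c \<le> a x t * p k x"
      unfolding c_def using a that p_low[of k x] K p_inf by (intro mult_mono) linarith+
    moreover have "a x t * p k x \<le> K2 * 1"
      using a that p_up[of k x] p_prob(1) K by (intro mult_mono) auto
    ultimately show ?thesis by (simp add: intensity_def)
  qed
  have intens_meas: "intensity_left a p k f \<in> borel_measurable (restrict_space borel {0..T})"
    if k: "k \<in> {1..n}" and f: "cadlag_on T f" for k f
  proof -
    have [measurable]: "f \<in> borel_measurable (restrict_space borel {0..T})"
      using f by (rule cadlag_on_measurable)
    have "continuous_on UNIV (p k)"
      using p_deriv(1) k by (meson DERIV_isCont continuous_at_imp_continuous_on)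
    then have [measurable]: "p k \<in> borel_measurable borel" by (rule borel_measurable_continuous_onI)
    have "(\<lambda>r. (f r, r)) \<in> measurable (restrict_space borel {0..T}) (borel \<Otimes>\<^sub>M restrict_space borel {0..T})"
      by measurable
    from measurable_compose[OF this a_meas]
    have [measurable]: "(\<lambda>r. a (f r) r) \<in> borel_measurable (restrict_space borel {0..T})" by simp
    have "(\<lambda>r. intensity a p k (f r) r) \<in> borel_measurable (restrict_space borel {0..T})"
      unfolding intensity_def by measurable
    then show ?thesis unfolding intensity_left_def[abs_def] by (rule left_lim_measurable)
  qed

  \<comment> \<open>The pathwise bound under Q\<close>
  define factor rate where "factor = max 1 (max K2 (1 / c))" and "rate = real n * (\<bar>K2\<bar> + 1)"
  have factor: "1 \<le> factor" by (simp add: factor_def)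
  \<comment> \<open>Path regularity of X is given under P and is carried over through the null
    sets.\<close>
  have "AE \<omega> in Q. cadlag_on T (\<lambda>t. X t \<omega>)"
    using X AE_transfer_equivalent_on[OF Q(3)[folded G_def] GP GQ null_G]
    by (simp add: state_equation_def)
  moreover have "AE \<omega> in Q. \<forall>k\<in>{1..n}. counting_path {0..T} (\<lambda>t. Y k t \<omega>)"
    using Q_Y by (intro AE_finite_allI) (auto simp: poisson_system_indep_of_def unit_poisson_process_def)
  moreover have "AE \<omega> in Q. \<forall>j\<in>{1..n}. \<forall>k\<in>{1..n}. j \<noteq> k \<longrightarrow>
      (\<forall>t\<in>{0<..T}. \<exists>s\<in>{0..<t}. Y j s \<omega> = Y j t \<omega> \<or> Y k s \<omega> = Y k t \<omega>)"
    using Q.poisson_no_common_jump[OF Q_Y T] by (intro AE_finite_allI[OF finite_atLeastAtMost] AE_impI) auto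
  moreover note M_eq[unfolded likelihood_equation_def Let_def]
  \<comment> \<open>\<open>factor\<close> and \<open>rate\<close> are the locale's \<open>D\<close>
    and \<open>C\<close> for K = K2, so they do not depend on the outcome. One null set serves all
    \<open>t\<close> and \<open>q\<close>. Nonvanishing is recorded because, with M(T) nonnegative,
    it gives the strict positivity that Young's inequality needs.\<close>
  ultimately have bound: "AE \<omega> in Q. \<forall>t\<in>{0..T}. M t \<omega> \<noteq> 0 \<and>
      (\<forall>q. \<bar>M t \<omega>\<bar> powr q \<le> (exp (rate * T) * factor ^ (\<Sum>k=1..n. Y k T \<omega>)) powr \<bar>q\<bar>)"
  proof eventually_elim
    case (elim \<omega>)
    interpret likelihood_path T c K2 n "\<lambda>k t. Y k t \<omega>" "\<lambda>k. intensity_left a p k (\<lambda>r. X r \<omega>)" "\<lambda>t. M t \<omega>"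
    proof
      show "c \<le> intensity_left a p k (\<lambda>r. X r \<omega>) t \<and> intensity_left a p k (\<lambda>r. X r \<omega>) t \<le> K2"
        if "k \<in> {1..n}" "t \<in> {0..T}" for k t
        using left_lim_bounds[of T "\<lambda>r. intensity a p k (X r \<omega>) r" c K2 t] intens[OF that(1)] that(2)
        unfolding intensity_left_def by auto
    qed (use elim T c intens_meas in blast)+
    show ?case
      using abs_powr_bound m_nonzero by (auto simp: R_def C_def D_def rate_def factor_def total_def)
  qed

  \<comment> \<open>Finite moments of the majorant\<close>
  have moment: "(\<integral>\<^sup>+\<omega>. ennreal ((exp (rate * T) * factor ^ (\<Sum>k=1..n. Y k T \<omega>)) powr r) \<partial>Q) < \<infinity>" for r
  proof (cases "0 \<le> r")
    case True
    define A z where "A = exp (rate * T) powr r" and "z = factor powr r"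
    have z: "1 \<le> z" using factor True by (simp add: z_def ge_one_powr_ge_zero)
    have [measurable]: "Y k T \<in> measurable Q (count_space UNIV)" if "k \<in> {1..n}" for k
      using Q_Y T that by (auto simp: poisson_system_indep_of_def unit_poisson_process_def)
    have le: "(exp (rate * T) * factor ^ (\<Sum>k=1..n. Y k T \<omega>)) powr r \<le> A * (\<Sum>k=1..n. (z ^ n) ^ Y k T \<omega>)" for \<omega>
    proof -
      have "(factor ^ N) powr r = z ^ N" for N
        using factor by (simp add: z_def powr_powr powr_realpow[symmetric] mult.commute)
      then have "(exp (rate * T) * factor ^ (\<Sum>k=1..n. Y k T \<omega>)) powr r = A * z ^ (\<Sum>k=1..n. Y k T \<omega>)"
        using factor by (simp add: powr_mult A_def)
      also have "\<dots> \<le> A * (\<Sum>k=1..n. (z ^ n) ^ Y k T \<omega>)"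
        by (intro mult_left_mono power_sum_le_sum_power[OF n z]) (simp add: A_def)
      finally show ?thesis .
    qed
    have "(\<integral>\<^sup>+\<omega>. ennreal ((exp (rate * T) * factor ^ (\<Sum>k=1..n. Y k T \<omega>)) powr r) \<partial>Q) \<le>
      (\<integral>\<^sup>+\<omega>. ennreal A * (\<Sum>k=1..n. ennreal ((z ^ n) ^ Y k T \<omega>)) \<partial>Q)"
      using le z by (intro nn_integral_mono) (simp add: ennreal_mult[symmetric] A_def sum_nonneg ennreal_leI del: power_mult)
    also have "\<dots> = ennreal A * (\<Sum>k=1..n. \<integral>\<^sup>+\<omega>. ennreal ((z ^ n) ^ Y k T \<omega>) \<partial>Q)"
      by (subst nn_integral_cmult, measurable, subst nn_integral_sum) (auto, measurable)
    also have "\<dots> < \<infinity>"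
    proof -
      have "(\<integral>\<^sup>+\<omega>. ennreal ((z ^ n) ^ Y k T \<omega>) \<partial>Q) < \<infinity>" if "k \<in> {1..n}" for k
        using Q.unit_poisson_process_exponential_moment[of T "Y k" "z ^ n"] Q_Y T z that
        by (auto simp: poisson_system_indep_of_def)
      then show ?thesis by (auto simp: ennreal_mult_less_top)
    qed
    finally show ?thesis .
  next
    case False
    have "(exp (rate * T) * factor ^ N) powr r \<le> 1" for N
    proof -
      have "1 * 1 \<le> exp (rate * T) * factor ^ N"
        using factor T by (intro mult_mono one_le_power) (auto simp: rate_def)
      then show ?thesis using False powr_mono2'[of r 1 "exp (rate * T) * factor ^ N"] by simp
    qed
    then have "(\<integral>\<^sup>+\<omega>. ennreal ((exp (rate * T) * factor ^ (\<Sum>k=1..n. Y k T \<omega>)) powr r) \<partial>Q) \<le> (\<integral>\<^sup>+\<omega>. 1 \<partial>Q)"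
      by (intro nn_integral_mono) (simp add: ennreal_le_1)
    then show ?thesis by (simp add: Q.emeasure_space_1 le_less_trans)
  qed

  have first: "(SUP t\<in>{0..T}. \<integral>\<^sup>+\<omega>. ennreal (\<bar>M t \<omega>\<bar> powr q) \<partial>Q) < \<infinity>" for q
  proof -
    have "(\<integral>\<^sup>+\<omega>. ennreal (\<bar>M t \<omega>\<bar> powr q) \<partial>Q) \<le>
      (\<integral>\<^sup>+\<omega>. ennreal ((exp (rate * T) * factor ^ (\<Sum>k=1..n. Y k T \<omega>)) powr \<bar>q\<bar>) \<partial>Q)" if "t \<in> {0..T}" for t
      using bound that by (intro nn_integral_mono_AE) (auto elim!: eventually_mono intro: ennreal_leI)
    then show ?thesis by (intro le_less_trans[OF SUP_least moment[of "\<bar>q\<bar>"]])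
  qed

  \<comment> \<open>Integrability of the controls under Q\<close>
  have second: "(\<integral>\<^sup>+\<omega>. (\<integral>\<^sup>+t\<in>{0..T}. ennreal (\<bar>u t \<omega>\<bar> ^ 4) \<partial>lborel) \<partial>Q) < \<infinity>"
    if u: "u \<in> admissible_controls T P U n Y" for u
  proof -
    from u obtain p0 where p0: "1 < p0"
      and fin: "(\<integral>\<^sup>+\<omega>. (\<integral>\<^sup>+t\<in>{0..T}. ennreal (\<bar>u t \<omega>\<bar> powr (4 * p0)) \<partial>lborel) \<partial>P) < \<infinity>"
      and pred: "predictable T (space P) (obs_algebra (space P) n Y) u"
      by (auto simp: admissible_controls_def)
    have "space G = space P" using GP by (simp add: subalgebra_def)
    moreover have "sets (obs_algebra (space P) n Y t) \<subseteq> sets G" if "t \<in> {0..T}" for t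
      using that by (intro order_trans[OF obs_algebra_mono obs_G]) auto
    ultimately have u_meas [measurable]: "(\<lambda>(t, \<omega>). u t \<omega>) \<in> borel_measurable (restrict_space lborel {0..T} \<Otimes>\<^sub>M G)"
      using T by (intro predictable_jointly_measurable[OF pred]) auto
    define I where "I \<omega> = (\<integral>\<^sup>+t. ennreal (\<bar>u t \<omega>\<bar> powr (4 * p0)) \<partial>restrict_space lborel {0..T})" for \<omega>
    define Z where "Z = M T"
    define r where "r = - (1 / (p0 - 1))"
    have restr: "(\<integral>\<^sup>+t\<in>{0..T}. f t \<partial>lborel) = (\<integral>\<^sup>+t. f t \<partial>restrict_space lborel {0..T})" for f :: "real \<Rightarrow> ennreal"
      by (simp add: nn_integral_restrict_space)
    interpret L: finite_measure "restrict_space lborel {0..T}"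
      using T by (intro finite_measureI) (simp add: emeasure_restrict_space space_restrict_space emeasure_lborel_Icc)
    have I_meas: "I \<in> borel_measurable G"
      unfolding I_def by measurable
    have ratio: "Z \<in> borel_measurable G" "AE \<omega> in Q. 0 \<le> Z \<omega>"
      "restr_to_subalg P G = density (restr_to_subalg Q G) (\<lambda>\<omega>. ennreal (Z \<omega>))"
      using M_ratio T unfolding likelihood_ratio_on_def G_def Z_def by auto
    \<comment> \<open>The density of P is known on \<open>G\<close> only, so the change of measure
      passes through the restrictions to \<open>G\<close>, where \<open>I\<close> is
      measurable.\<close>
    have "(\<integral>\<^sup>+\<omega>. I \<omega> \<partial>P) = (\<integral>\<^sup>+\<omega>. I \<omega> \<partial>restr_to_subalg P G)"
      using nn_integral_subalgebra2[OF GP I_meas] by simp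
    also have "\<dots> = (\<integral>\<^sup>+\<omega>. ennreal (Z \<omega>) * I \<omega> \<partial>restr_to_subalg Q G)"
      unfolding ratio(3) using I_meas ratio(1) GQ
      by (intro nn_integral_density) (auto simp: sets_restr_to_subalg cong: measurable_cong_sets)
    also have "\<dots> = (\<integral>\<^sup>+\<omega>. ennreal (Z \<omega>) * I \<omega> \<partial>Q)"
      using I_meas ratio(1) by (intro nn_integral_subalgebra2[OF GQ]) measurable
    finally have change: "(\<integral>\<^sup>+\<omega>. ennreal (Z \<omega>) * I \<omega> \<partial>Q) = (\<integral>\<^sup>+\<omega>. I \<omega> \<partial>P)" ..
    \<comment> \<open>Young's inequality is used at each time with the same z = M(T); its second
      term is constant in time and contributes the factor T.\<close>
    have "AE \<omega> in Q. (\<integral>\<^sup>+t\<in>{0..T}. ennreal (\<bar>u t \<omega>\<bar> ^ 4) \<partial>lborel) \<le>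
      ennreal (Z \<omega>) * I \<omega> + ennreal T * ennreal (\<bar>Z \<omega>\<bar> powr r)"
      using bound ratio(2) AE_space
    proof eventually_elim
      case (elim \<omega>)
      then have Z: "0 < Z \<omega>" and \<omega>: "\<omega> \<in> space G"
        using T \<open>space G = space P\<close> spQ by (auto simp: Z_def less_le)
      have [measurable]: "(\<lambda>t. u t \<omega>) \<in> borel_measurable (restrict_space lborel {0..T})"
        using measurable_compose[OF measurable_Pair2'[OF \<omega>] u_meas] by simp
      have "(\<integral>\<^sup>+t\<in>{0..T}. ennreal (\<bar>u t \<omega>\<bar> ^ 4) \<partial>lborel) \<le>
        (\<integral>\<^sup>+t. ennreal (Z \<omega>) * ennreal (\<bar>u t \<omega>\<bar> powr (4 * p0)) + ennreal (\<bar>Z \<omega>\<bar> powr r) \<partial>restrict_space lborel {0..T})"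
        unfolding restr using young_power4[OF Z p0] Z
        by (intro nn_integral_mono) (simp add: r_def mult.commute flip: ennreal_mult ennreal_plus)
      also have "\<dots> = ennreal (Z \<omega>) * I \<omega> + ennreal (\<bar>Z \<omega>\<bar> powr r) * emeasure (restrict_space lborel {0..T}) {0..T}"
        by (simp add: nn_integral_add nn_integral_cmult I_def space_restrict_space)
      also have "emeasure (restrict_space lborel {0..T}) {0..T} = ennreal T"
        using T by (simp add: emeasure_restrict_space)
      finally show ?case by (simp add: mult.commute)
    qed
    then have "(\<integral>\<^sup>+\<omega>. (\<integral>\<^sup>+t\<in>{0..T}. ennreal (\<bar>u t \<omega>\<bar> ^ 4) \<partial>lborel) \<partial>Q) \<le>
      (\<integral>\<^sup>+\<omega>. ennreal (Z \<omega>) * I \<omega> + ennreal T * ennreal (\<bar>Z \<omega>\<bar> powr r) \<partial>Q)"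
      by (rule nn_integral_mono_AE)
    also have "\<dots> = (\<integral>\<^sup>+\<omega>. I \<omega> \<partial>P) + ennreal T * (\<integral>\<^sup>+\<omega>. ennreal (\<bar>Z \<omega>\<bar> powr r) \<partial>Q)"
    proof -
      have [measurable]: "I \<in> borel_measurable Q" "Z \<in> borel_measurable Q"
        using I_meas ratio(1) GQ by (auto intro: measurable_from_subalg)
      show ?thesis unfolding change[symmetric] by (simp add: nn_integral_add nn_integral_cmult)
    qed
    also have "\<dots> < \<infinity>"
    proof -
      have "(\<integral>\<^sup>+\<omega>. ennreal (\<bar>Z \<omega>\<bar> powr r) \<partial>Q) \<le> (SUP t\<in>{0..T}. \<integral>\<^sup>+\<omega>. ennreal (\<bar>M t \<omega>\<bar> powr r) \<partial>Q)"
        unfolding Z_def using T by (intro SUP_upper) auto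
      then have "(\<integral>\<^sup>+\<omega>. ennreal (\<bar>Z \<omega>\<bar> powr r) \<partial>Q) < \<infinity>" using first[of r] by (rule le_less_trans)
      moreover have "(\<integral>\<^sup>+\<omega>. I \<omega> \<partial>P) < \<infinity>" using fin unfolding restr I_def .
      ultimately show ?thesis by (simp add: ennreal_mult_less_top)
    qed
    finally show ?thesis .
  qed
  show ?thesis using first second by blast
qed

end
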